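(* Conditions (A1), (A2''), (A3') do not imply (C1): there exist a Banach space $(X,\|\cdot\|_X)$ and a functional $I\in C^1(X,\mathbb{R})$ satisfying (A1), (A2'') and (A3') for which (C1) does not hold. In particular, there exist a Banach space $X$ and $I\in C^1(X,\mathbb{R})$ satisfying (A1), (A2'') and (A3) for which (C1) does not hold. Here the conditions are: (A1) $I(0)=0$, $I(u)$ is even in $u$ and bounded from below; (A2'') $I(u)$ satisfies the $(PS)_c$ condition for all $c\le 0$; (A3) for any $k\in\mathbb{N}$ there exists $A\in\mathcal{E}$ such that $\gamma(A)\ge k$ and $\sup_{u\in A}I(u)<0$; (A3') for any $k\in\mathbb{N}$ there exist a $k$-dimensional subspace $X^k$ of $X$ and $\rho_k>0$ such that $\sup\{I(u): u\in X^k,\ \|u\|_X=\rho_k\}<0$; (C1) there exists a sequence $(u_j)_{j=1}^\infty\subset X$ such that $I'(u_j)=0$ and $I(u_j)<0$ for all $j$, and $u_j\to 0$ as $j\to\infty$.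
   Context: $X$ is a real Banach space with dual $X^*$; $\mathbb{N}=\{1,2,\dots\}$. $(PS)_c$: for $c\in\mathbb{R}$, $I$ satisfies $(PS)_c$ if any sequence $(u_j)_{j=1}^\infty\subset X$ with $I(u_j)\to c$ and $\|I'(u_j)\|_{X^*}\to 0$ has a (norm-)convergent subsequence. $\mathcal{E}$ is the family of sets $A\subset X\setminus\{0\}$ that are closed (in $X$) and symmetric with respect to $0$. For $A\in\mathcal{E}$, the (Krasnosel'skii) genus $\gamma(A)$ is the smallest integer $n$ such that there exists an odd continuous map $\zeta\in C(A,\mathbb{R}^n\setminus\{0\})$; if no such map exists for any $n$, $\gamma(A)=\infty$; $\gamma(\emptyset)=0$. *)

theory Defs
  imports "HOL-Analysis.Analysis" "HOL-Library.Function_Algebras"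
begin

text \<open>
  The theorem asserts the existence of a Banach space. HOL cannot quantify over types inside a
  formula, so a Banach space is a pair of a linear subspace \<open>X\<close> of an ambient real vector space
  and an arbitrary complete norm \<open>nrm\<close> on \<open>X\<close>, unrelated to any topology of the ambient type.
  The ambient type is used only for its linear structure. Only the values of \<open>nrm\<close> and of
  functionals on \<open>X\<close> matter.

  The pointwise structure below makes \<open>nat \<Rightarrow> real\<close> available as ambient space. Its algebraic
  dimension is that of the continuum, so every Banach space of cardinality at most the
  continuum, in particular every separable one, is isometrically isomorphic to some such
  \<open>(X, nrm)\<close>.
\<close>

instantiation "fun" :: (type, real_vector) real_vector
begin

definition scaleR_fun :: "real \<Rightarrow> ('a \<Rightarrow> 'b) \<Rightarrow> 'a \<Rightarrow> 'b" where
  "scaleR_fun c f = (\<lambda>x. c *\<^sub>R f x)"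

instance
  by standard (simp_all add: scaleR_fun_def fun_eq_iff scaleR_add_right scaleR_add_left)

end

text \<open>\<open>Metric_space\<close> wants nonnegativity and symmetry on the whole type, hence the value 0
  outside \<open>X\<close>.\<close>

definition norm_dist :: "'a::real_vector set \<Rightarrow> ('a \<Rightarrow> real) \<Rightarrow> 'a \<Rightarrow> 'a \<Rightarrow> real" where
  "norm_dist X nrm x y = (if x \<in> X \<and> y \<in> X then nrm (x - y) else 0)"

definition normed_space_on :: "'a::real_vector set \<Rightarrow> ('a \<Rightarrow> real) \<Rightarrow> bool" where
  "normed_space_on X nrm \<longleftrightarrow>
     subspace X \<and>
     (\<forall>x\<in>X. 0 \<le> nrm x) \<and>
     (\<forall>x\<in>X. nrm x = 0 \<longleftrightarrow> x = 0) \<and>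
     (\<forall>c. \<forall>x\<in>X. nrm (c *\<^sub>R x) = \<bar>c\<bar> * nrm x) \<and>
     (\<forall>x\<in>X. \<forall>y\<in>X. nrm (x + y) \<le> nrm x + nrm y)"

definition banach_space_on :: "'a::real_vector set \<Rightarrow> ('a \<Rightarrow> real) \<Rightarrow> bool" where
  "banach_space_on X nrm \<longleftrightarrow>
     normed_space_on X nrm \<and> Metric_space.mcomplete X (norm_dist X nrm)"

definition norm_topology :: "'a::real_vector set \<Rightarrow> ('a \<Rightarrow> real) \<Rightarrow> 'a topology" where
  "norm_topology X nrm = Metric_space.mtopology X (norm_dist X nrm)"

lemma Metric_space_norm_dist:
  assumes "normed_space_on X nrm"
  shows "Metric_space X (norm_dist X nrm)"
proof
  have X: "subspace X"
    and nn: "\<And>x. x \<in> X \<Longrightarrow> 0 \<le> nrm x"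
    and z: "\<And>x. x \<in> X \<Longrightarrow> nrm x = 0 \<longleftrightarrow> x = 0"
    and sc: "\<And>c x. x \<in> X \<Longrightarrow> nrm (c *\<^sub>R x) = \<bar>c\<bar> * nrm x"
    and tri: "\<And>x y. x \<in> X \<Longrightarrow> y \<in> X \<Longrightarrow> nrm (x + y) \<le> nrm x + nrm y"
    using assms by (auto simp: normed_space_on_def)
  show "0 \<le> norm_dist X nrm x y" for x y
    by (simp add: norm_dist_def nn subspace_diff[OF X])
  show "norm_dist X nrm x y = norm_dist X nrm y x" for x y
    using sc[of "x - y" "-1"] by (simp add: norm_dist_def subspace_diff[OF X])
  show "norm_dist X nrm x y = 0 \<longleftrightarrow> x = y" if "x \<in> X" "y \<in> X" for x y
    using that by (simp add: norm_dist_def z subspace_diff[OF X])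
  show "norm_dist X nrm x w \<le> norm_dist X nrm x y + norm_dist X nrm y w"
    if "x \<in> X" "y \<in> X" "w \<in> X" for x y w
    using that tri[of "x - y" "y - w"] by (simp add: norm_dist_def subspace_diff[OF X])
qed

text \<open>The dual space consists of functions on the whole ambient type; setting them to 0 outside
  \<open>X\<close> makes a functional on \<open>X\<close> correspond to exactly one of them.\<close>

definition dual_space :: "'a::real_vector set \<Rightarrow> ('a \<Rightarrow> real) \<Rightarrow> ('a \<Rightarrow> real) set" where
  "dual_space X nrm = {\<phi>.
     (\<forall>x\<in>X. \<forall>y\<in>X. \<phi> (x + y) = \<phi> x + \<phi> y) \<and>
     (\<forall>c. \<forall>x\<in>X. \<phi> (c *\<^sub>R x) = c * \<phi> x) \<and>
     (\<exists>C. \<forall>x\<in>X. \<bar>\<phi> x\<bar> \<le> C * nrm x) \<and>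
     (\<forall>x. x \<notin> X \<longrightarrow> \<phi> x = 0)}"

definition dual_norm :: "'a::real_vector set \<Rightarrow> ('a \<Rightarrow> real) \<Rightarrow> ('a \<Rightarrow> real) \<Rightarrow> real" where
  "dual_norm X nrm \<phi> = (SUP h\<in>{h\<in>X. nrm h \<le> 1}. \<bar>\<phi> h\<bar>)"

definition has_frechet_derivative_on ::
  "'a::real_vector set \<Rightarrow> ('a \<Rightarrow> real) \<Rightarrow> ('a \<Rightarrow> real) \<Rightarrow> ('a \<Rightarrow> real) \<Rightarrow> 'a \<Rightarrow> bool" where
  "has_frechet_derivative_on X nrm I \<phi> u \<longleftrightarrow>
     \<phi> \<in> dual_space X nrm \<and>
     (\<forall>\<epsilon>>0. \<exists>\<delta>>0. \<forall>h\<in>X. nrm h < \<delta> \<longrightarrow> \<bar>I (u + h) - I u - \<phi> h\<bar> \<le> \<epsilon> * nrm h)"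

definition frechet_derivative_on ::
  "'a::real_vector set \<Rightarrow> ('a \<Rightarrow> real) \<Rightarrow> ('a \<Rightarrow> real) \<Rightarrow> 'a \<Rightarrow> ('a \<Rightarrow> real)" where
  "frechet_derivative_on X nrm I u = (THE \<phi>. has_frechet_derivative_on X nrm I \<phi> u)"

lemma has_frechet_derivative_on_unique:
  assumes N: "normed_space_on X nrm"
    and d1: "has_frechet_derivative_on X nrm I \<phi> u"
    and d2: "has_frechet_derivative_on X nrm I \<psi> u"
  shows "\<phi> = \<psi>"
proof
  have lin: "\<And>x. x \<notin> X \<Longrightarrow> \<phi> x = 0" "\<And>c x. x \<in> X \<Longrightarrow> \<phi> (c *\<^sub>R x) = c * \<phi> x"
    "\<And>x. x \<notin> X \<Longrightarrow> \<psi> x = 0" "\<And>c x. x \<in> X \<Longrightarrow> \<psi> (c *\<^sub>R x) = c * \<psi> x"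
    using d1 d2 unfolding has_frechet_derivative_on_def dual_space_def by blast+
  fix h
  show "\<phi> h = \<psi> h"
  proof (cases "h \<in> X \<and> h \<noteq> 0")
    case False
    have "0 \<in> X" using N by (simp add: normed_space_on_def subspace_0)
    then have "\<phi> 0 = 0 \<and> \<psi> 0 = 0"
      using lin(2)[of 0 0] lin(4)[of 0 0] by simp
    with False lin(1,3) show ?thesis by metis
  next
    case True
    then have h: "h \<in> X" and hp: "0 < nrm h"
      using N unfolding normed_space_on_def by (auto simp: less_le)
    have "\<bar>\<phi> h - \<psi> h\<bar> \<le> 0 + e" if "e > 0" for e
    proof -
      define \<epsilon> where "\<epsilon> = e / (2 * nrm h)"
      have "\<epsilon> > 0" using that hp by (simp add: \<epsilon>_def)
      obtain a where a: "a > 0"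
        "\<And>k. k \<in> X \<Longrightarrow> nrm k < a \<Longrightarrow> \<bar>I (u + k) - I u - \<phi> k\<bar> \<le> \<epsilon> * nrm k"
        using d1 \<open>\<epsilon> > 0\<close> unfolding has_frechet_derivative_on_def by blast
      obtain b where b: "b > 0"
        "\<And>k. k \<in> X \<Longrightarrow> nrm k < b \<Longrightarrow> \<bar>I (u + k) - I u - \<psi> k\<bar> \<le> \<epsilon> * nrm k"
        using d2 \<open>\<epsilon> > 0\<close> unfolding has_frechet_derivative_on_def by blast
      define t where "t = min a b / (2 * nrm h)"
      have t: "t > 0" using a b hp by (simp add: t_def)
      have nt: "nrm (t *\<^sub>R h) = t * nrm h" using N h t by (simp add: normed_space_on_def)
      have "t * nrm h < a" "t * nrm h < b" using a b hp by (auto simp: t_def min_def)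
      moreover have "t *\<^sub>R h \<in> X" using N h by (simp add: normed_space_on_def subspace_scale)
      ultimately have
        "\<bar>I (u + t *\<^sub>R h) - I u - \<phi> (t *\<^sub>R h)\<bar> \<le> \<epsilon> * (t * nrm h)"
        "\<bar>I (u + t *\<^sub>R h) - I u - \<psi> (t *\<^sub>R h)\<bar> \<le> \<epsilon> * (t * nrm h)"
        using a(2)[of "t *\<^sub>R h"] b(2)[of "t *\<^sub>R h"] nt by simp_all
      then have "\<bar>\<phi> (t *\<^sub>R h) - \<psi> (t *\<^sub>R h)\<bar> \<le> 2 * (\<epsilon> * (t * nrm h))"
        by linarith
      moreover have "\<phi> (t *\<^sub>R h) = t * \<phi> h" "\<psi> (t *\<^sub>R h) = t * \<psi> h"
        using lin h by blast+
      ultimately have "t * \<bar>\<phi> h - \<psi> h\<bar> \<le> t * e"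
        using t hp by (simp add: \<epsilon>_def abs_mult flip: right_diff_distrib)
      then show ?thesis using t by simp
    qed
    then have "\<bar>\<phi> h - \<psi> h\<bar> \<le> 0" by (rule field_le_epsilon)
    then show ?thesis by simp
  qed
qed

definition C1_functional_on ::
  "'a::real_vector set \<Rightarrow> ('a \<Rightarrow> real) \<Rightarrow> ('a \<Rightarrow> real) \<Rightarrow> bool" where
  "C1_functional_on X nrm I \<longleftrightarrow>
     (\<forall>u\<in>X. \<exists>\<phi>. has_frechet_derivative_on X nrm I \<phi> u) \<and>
     (\<forall>u\<in>X. \<forall>\<epsilon>>0. \<exists>\<delta>>0. \<forall>v\<in>X. nrm (v - u) < \<delta> \<longrightarrow>
        dual_norm X nrm (frechet_derivative_on X nrm I v - frechet_derivative_on X nrm I u) < \<epsilon>)"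

definition palais_smale ::
  "'a::real_vector set \<Rightarrow> ('a \<Rightarrow> real) \<Rightarrow> ('a \<Rightarrow> real) \<Rightarrow> real \<Rightarrow> bool" where
  "palais_smale X nrm I c \<longleftrightarrow>
     (\<forall>u :: nat \<Rightarrow> 'a. (\<forall>j. u j \<in> X) \<longrightarrow>
        (\<lambda>j. I (u j)) \<longlonglongrightarrow> c \<longrightarrow>
        (\<lambda>j. dual_norm X nrm (frechet_derivative_on X nrm I (u j))) \<longlonglongrightarrow> 0 \<longrightarrow>
        (\<exists>l r. strict_mono (r :: nat \<Rightarrow> nat) \<and>
           limitin (norm_topology X nrm) (u \<circ> r) l sequentially))"

definition closed_symmetric_sets ::
  "'a::real_vector set \<Rightarrow> ('a \<Rightarrow> real) \<Rightarrow> 'a set set" where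
  "closed_symmetric_sets X nrm =
     {A. A \<subseteq> X - {0} \<and> closedin (norm_topology X nrm) A \<and> (\<forall>x\<in>A. - x \<in> A)}"

text \<open>\<open>Euclidean_space n\<close> is the space of real sequences vanishing from index \<open>n\<close> on. For \<open>n = 0\<close>
  it is \<open>{0}\<close>, so \<open>n = 0\<close> is admissible exactly for \<open>A = {}\<close>, which gives genus 0 to the empty
  set; the infimum of the empty set in \<^typ>\<open>enat\<close> is \<open>\<infinity>\<close>.\<close>

definition genus :: "'a::real_vector set \<Rightarrow> ('a \<Rightarrow> real) \<Rightarrow> 'a set \<Rightarrow> enat" where
  "genus X nrm A =
     Inf {enat n | n. \<exists>\<zeta> :: 'a \<Rightarrow> nat \<Rightarrow> real.
        continuous_map (subtopology (norm_topology X nrm) A) (Euclidean_space n) \<zeta> \<and>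
        (\<forall>x\<in>A. \<zeta> x \<noteq> 0) \<and> (\<forall>x\<in>A. \<zeta> (- x) = - \<zeta> x)}"

definition cond_A1 :: "'a::real_vector set \<Rightarrow> ('a \<Rightarrow> real) \<Rightarrow> bool" where
  "cond_A1 X I \<longleftrightarrow> I 0 = 0 \<and> (\<forall>u\<in>X. I (- u) = I u) \<and> bdd_below (I ` X)"

definition cond_A2'' :: "'a::real_vector set \<Rightarrow> ('a \<Rightarrow> real) \<Rightarrow> ('a \<Rightarrow> real) \<Rightarrow> bool" where
  "cond_A2'' X nrm I \<longleftrightarrow> (\<forall>c\<le>0. palais_smale X nrm I c)"

text \<open>Suprema are taken in \<^typ>\<open>ereal\<close>, since \<open>Sup\<close> on \<^typ>\<open>real\<close> is unspecified for sets that are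
  unbounded above.\<close>

definition cond_A3 :: "'a::real_vector set \<Rightarrow> ('a \<Rightarrow> real) \<Rightarrow> ('a \<Rightarrow> real) \<Rightarrow> bool" where
  "cond_A3 X nrm I \<longleftrightarrow>
     (\<forall>k\<ge>1. \<exists>A\<in>closed_symmetric_sets X nrm.
        enat k \<le> genus X nrm A \<and> (SUP u\<in>A. ereal (I u)) < 0)"

definition cond_A3' :: "'a::real_vector set \<Rightarrow> ('a \<Rightarrow> real) \<Rightarrow> ('a \<Rightarrow> real) \<Rightarrow> bool" where
  "cond_A3' X nrm I \<longleftrightarrow>
     (\<forall>k\<ge>1. \<exists>Y \<rho>. subspace Y \<and> Y \<subseteq> X \<and> dim Y = k \<and> \<rho> > 0 \<and>
        (SUP u\<in>{u\<in>Y. nrm u = \<rho>}. ereal (I u)) < 0)"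

definition cond_C1 :: "'a::real_vector set \<Rightarrow> ('a \<Rightarrow> real) \<Rightarrow> ('a \<Rightarrow> real) \<Rightarrow> bool" where
  "cond_C1 X nrm I \<longleftrightarrow>
     (\<exists>u :: nat \<Rightarrow> 'a.
        (\<forall>j. u j \<in> X \<and> frechet_derivative_on X nrm I (u j) = 0 \<and> I (u j) < 0) \<and>
        limitin (norm_topology X nrm) u 0 sequentially)"

end

theory Submission
  imports Defs "HOL-Homology.Homology"
begin

text \<open>
  The example lives on a weighted space of square summable sequences \<open>(t, y 1, y 2, \<dots>)\<close>, with the
  weight \<open>4\<^sup>-\<^sup>i\<close> on coordinate \<open>i\<close>, and the functional is
  \<open>I (t, y) = trough t + (\<Sum>i. 4\<^sup>-\<^sup>i * (well (y i) + t * tilt (y i)))\<close>.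

  For \<open>t = 0\<close> it is a sum of scaled double wells. The wells have the critical points \<open>0\<close> and
  \<open>\<plusminus>2\<close>, so in the variables \<open>y\<close> alone the points with \<open>\<plusminus>2\<close> in a single coordinate would be critical
  points of negative energy that converge to the origin. The additional variable destroys them: the
  derivative in \<open>t\<close> is, for \<open>\<bar>t\<bar> \<le> 1\<close>, the number \<open>\<Sum>i. 4\<^sup>-\<^sup>i * tilt (y i)\<close>. At a point that is critical in
  all \<open>y i\<close> and has \<open>\<bar>t\<bar> \<le> 1 / 2\<close>, every \<open>tilt (y i)\<close> is zero or has absolute value between 1 and 2, and the
  first nonzero term of the sum outweighs all later ones. The derivative can vanish only if all \<open>y i\<close>
  do, and on the axis \<open>y = 0\<close> the energy is 0. So there is no critical point of negative energy near the
  origin (\<open>energy_critical_near_axis\<close>), and (C1) fails.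

  The Palais-Smale condition holds at every level (\<open>palais_smale_energy\<close>): a small gradient confines
  the coordinates to a bounded range, up to an error that is small in norm, and sets of sequences
  with uniformly bounded coordinates are relatively compact because the weights are summable
  (\<open>ell2_compactness\<close>).

  On a small sphere in the space of the first \<open>k\<close> variables \<open>y i\<close> the energy is minus half the squared
  norm (\<open>energy_small_sphere\<close>), which gives (A3'). For (A3) the genus of this sphere has to be at
  least \<open>k\<close>. That is the Borsuk-Ulam theorem, proved here with singular chains: the hemispheres of a
  sphere form a tower of chains linked by the boundary operator and the antipode, odd maps transport
  such towers, and punctured Euclidean space admits none of full height
  (\<open>no_antipodal_tower_punctured_Euclidean_space\<close>), since restricting a tower to a symmetric
  neighbourhood of the equator costs only one level (\<open>antipodal_tower_restrict\<close>).
\<close>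

section \<open>The Borsuk-Ulam theorem\<close>

text \<open>
  The sum of the coefficients of a chain. Collapsing all simplices to one generator reduces its
  additivity to that of \<^const>\<open>frag_extend\<close>.
\<close>

definition augmentation :: "('b \<Rightarrow>\<^sub>0 int) \<Rightarrow> int" where
  "augmentation c = poly_mapping.lookup (frag_extend (\<lambda>_. frag_of ()) c) ()"

lemma augmentation_simps [simp]:
  "augmentation 0 = 0"
  "augmentation (frag_of f) = 1"
  "augmentation (a + b) = augmentation a + augmentation b"
  "augmentation (a - b) = augmentation a - augmentation b"
  "augmentation (- a) = - augmentation a"
  "augmentation (frag_cmul k a) = k * augmentation a"
  by (simp_all add: augmentation_def frag_extend_add frag_extend_diff frag_extend_minus
      frag_extend_cmul lookup_add lookup_minus)

lemma augmentation_chain_map [simp]: "augmentation (chain_map p g c) = augmentation c"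
  using subset_UNIV by (induction c rule: frag_induction) (auto simp: chain_map_diff)

lemma augmentation_chain_boundary [simp]: "augmentation (chain_boundary (Suc 0) c) = 0"
  using subset_UNIV
  by (induction c rule: frag_induction) (auto simp: chain_boundary_diff chain_boundary_of)

lemma chain_map_uminus_uminus:
  fixes X :: "'a::group_add topology"
  assumes "singular_chain p X c"
  shows "chain_map p uminus (chain_map p uminus c) = c"
proof -
  have "chain_map p uminus (chain_map p uminus c) = chain_map p (uminus \<circ> uminus :: 'a \<Rightarrow> 'a) c"
    by (simp only: chain_map_compose o_apply)
  also have "\<dots> = c"
    using assms by (rule chain_map_id_gen) simp
  finally show ?thesis .
qed

text \<open>
  A chain-level substitute for an odd map from the \<open>n\<close>-sphere to \<open>X\<close>. The model is the
  family of upper hemispheres: \<open>d i\<close> is the image of the upper hemisphere of the \<open>i\<close>-sphere, whose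
  boundary consists of the upper and the lower hemisphere of the \<open>(i - 1)\<close>-sphere. The sign is the
  one for which the right-hand side is a cycle. A single point has augmentation 1, but passing to a
  symmetric subset of \<open>X\<close> below changes the augmentation by an even number, so only its parity is
  required.
\<close>

definition antipodal_tower :: "nat \<Rightarrow> 'a::group_add topology \<Rightarrow> (nat \<Rightarrow> 'a chain) \<Rightarrow> bool" where
  "antipodal_tower n X d \<longleftrightarrow>
     (\<forall>i\<le>n. singular_chain i X (d i)) \<and>
     (\<forall>i<n. chain_boundary (Suc i) (d (Suc i)) =
            chain_map i uminus (d i) + frag_cmul ((-1) ^ Suc i) (d i)) \<and>
     odd (augmentation (d 0))"

lemma antipodal_tower_chain_map:
  fixes X :: "'a::group_add topology" and Y :: "'b::group_add topology"
  assumes d: "antipodal_tower n X d" and g: "continuous_map X Y g"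
    and odd: "\<And>x. x \<in> topspace X \<Longrightarrow> g (- x) = - g x"
  shows "antipodal_tower n Y (\<lambda>i. chain_map i g (d i))"
proof -
  have sing: "singular_chain i X (d i)" if "i \<le> n" for i
    using d that by (simp add: antipodal_tower_def)
  have comm: "chain_map i g (chain_map i uminus (d i)) = chain_map i uminus (chain_map i g (d i))"
    if "i \<le> n" for i
  proof -
    have "chain_map i (g \<circ> uminus) (d i) = chain_map i (uminus \<circ> g) (d i)"
      using sing[OF that] by (rule chain_map_eq) (simp add: odd)
    then show ?thesis by (simp add: chain_map_compose)
  qed
  show ?thesis
    unfolding antipodal_tower_def
  proof (intro conjI allI impI)
    fix i assume "i < n"
    then have "chain_boundary (Suc i) (chain_map (Suc i) g (d (Suc i))) =
        chain_map i g (chain_boundary (Suc i) (d (Suc i)))"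
      using chain_boundary_chain_map[OF sing[of "Suc i"]] by simp
    also have "\<dots> = chain_map i g (chain_map i uminus (d i) + frag_cmul ((-1) ^ Suc i) (d i))"
      using d \<open>i < n\<close> by (simp add: antipodal_tower_def)
    also have "\<dots> = chain_map i uminus (chain_map i g (d i)) +
        frag_cmul ((-1) ^ Suc i) (chain_map i g (d i))"
      using comm \<open>i < n\<close> by (simp only: chain_map_add chain_map_cmul less_imp_le)
    finally show "chain_boundary (Suc i) (chain_map (Suc i) g (d (Suc i))) =
        chain_map i uminus (chain_map i g (d i)) +
        frag_cmul ((-1) ^ Suc i) (chain_map i g (d i))" .
  qed (use d g in \<open>auto simp: antipodal_tower_def intro: singular_chain_chain_map\<close>)
qed

lemma singular_subdivision_uminus: "singular_subdivision p (- c) = - singular_subdivision p c"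
  using singular_subdivision_diff[of p 0 c] by simp

lemma singular_subdivision_sign:
  "singular_subdivision p (frag_cmul ((-1) ^ k) c) = frag_cmul ((-1) ^ k) (singular_subdivision p c)"
  by (cases "even k") (simp_all add: singular_subdivision_uminus)

lemma antipodal_tower_subdivision:
  assumes "antipodal_tower n X d"
  shows "antipodal_tower n X (\<lambda>i. (singular_subdivision i ^^ m) (d i))"
proof (induction m)
  case 0
  then show ?case using assms by simp
next
  case (Suc m)
  define e where "e = (\<lambda>i. (singular_subdivision i ^^ m) (d i))"
  have e: "antipodal_tower n X e"
    using Suc by (simp add: e_def)
  have sing: "singular_chain i X (e i)" if "i \<le> n" for i
    using e that by (simp add: antipodal_tower_def)
  have "antipodal_tower n X (\<lambda>i. singular_subdivision i (e i))"
    unfolding antipodal_tower_def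
  proof (intro conjI allI impI)
    fix i assume i: "i < n"
    have "chain_boundary (Suc i) (singular_subdivision (Suc i) (e (Suc i))) =
        singular_subdivision i (chain_boundary (Suc i) (e (Suc i)))"
      using chain_boundary_singular_subdivision[OF sing[of "Suc i"]] i by simp
    also have "\<dots> = singular_subdivision i (chain_map i uminus (e i) + frag_cmul ((-1) ^ Suc i) (e i))"
      using e i by (simp add: antipodal_tower_def)
    also have "\<dots> = chain_map i uminus (singular_subdivision i (e i)) +
        frag_cmul ((-1) ^ Suc i) (singular_subdivision i (e i))"
      using naturality_singular_subdivision[OF sing[of i], of uminus] i
      by (simp only: singular_subdivision_add singular_subdivision_sign less_imp_le)
    finally show "chain_boundary (Suc i) (singular_subdivision (Suc i) (e (Suc i))) =
        chain_map i uminus (singular_subdivision i (e i)) +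
        frag_cmul ((-1) ^ Suc i) (singular_subdivision i (e i))" .
  next
    show "odd (augmentation (singular_subdivision 0 (e 0)))"
      using e sing[of 0] singular_subdivision_zero[of X "e 0"] by (auto simp: antipodal_tower_def)
  qed (simp add: sing singular_chain_singular_subdivision)
  then show ?case by (simp add: e_def)
qed

text \<open>
  The loss of one level when \<open>X\<close> is covered by an open set and its mirror image. After subdivision
  every simplex lies in \<open>U\<close> or in \<open>- U\<close>, and the second kind can be moved to the first by the antipode
  \<open>T\<close>; with \<open>s i = (-1) ^ i\<close> this gives \<open>d i = c i + (T + s i) (b i)\<close> with \<open>c i\<close> and \<open>b i\<close> in \<open>U\<close>.
  As \<open>(T + s (i + 1)) (T + s i) = 0\<close>, the tower relation becomes
  \<open>\<partial> (c (i + 1)) = (T + s (i + 1)) (w i)\<close> for \<open>w i = c i - \<partial> (b (i + 1))\<close>. Here \<open>w i\<close> and the left-hand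
  side lie in \<open>U\<close>, hence so does \<open>T (w i)\<close>. So \<open>w i\<close> lives on the intersection of \<open>U\<close> and \<open>- U\<close>, and
  the \<open>w i\<close> satisfy the same relation.
\<close>

lemma antipodal_tower_restrict:
  fixes X :: "'a::group_add topology"
  assumes d: "antipodal_tower (Suc n) X d"
    and sym: "continuous_map X X uminus"
    and U: "openin X U"
    and cover: "\<And>x. x \<in> topspace X \<Longrightarrow> x \<in> U \<or> - x \<in> U"
  obtains w where "antipodal_tower n (subtopology X {x. x \<in> U \<and> - x \<in> U}) w"
proof -
  define V where "V = {x \<in> topspace X. - x \<in> U}"
  have V: "openin X V"
    using openin_continuous_map_preimage[OF sym U] by (simp add: V_def)
  have mU: "continuous_map (subtopology X V) (subtopology X U) uminus"
    using sym by (auto simp: continuous_map_in_subtopology V_def intro: continuous_map_from_subtopology)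
  have mV: "continuous_map (subtopology X U) (subtopology X V) uminus"
    using continuous_map_from_subtopology[OF sym, of U] continuous_map_image_subset_topspace[OF sym]
    by (auto simp: continuous_map_in_subtopology V_def)
  have "\<exists>N. \<forall>m\<ge>N. \<forall>f\<in>Poly_Mapping.keys ((singular_subdivision i ^^ m) (d i)).
      f \<in> standard_simplex i \<rightarrow> U \<or> f \<in> standard_simplex i \<rightarrow> V" if "i \<le> Suc n" for i
  proof -
    have "singular_chain i X (d i)"
      using d that by (simp add: antipodal_tower_def)
    then obtain N where "\<And>m f. N \<le> m \<Longrightarrow> f \<in> Poly_Mapping.keys ((singular_subdivision i ^^ m) (d i)) \<Longrightarrow>
        \<exists>W\<in>{U, V}. f \<in> standard_simplex i \<rightarrow> W"
      by (rule sufficient_iterated_singular_subdivision_exists[of "{U, V}" X i "d i", rotated 2])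
        (use U V cover in \<open>auto simp: V_def\<close>)
    then show ?thesis by blast
  qed
  then obtain N where N: "\<And>i m f. i \<le> Suc n \<Longrightarrow> N i \<le> m \<Longrightarrow>
      f \<in> Poly_Mapping.keys ((singular_subdivision i ^^ m) (d i)) \<Longrightarrow>
      f \<in> standard_simplex i \<rightarrow> U \<or> f \<in> standard_simplex i \<rightarrow> V"
    by metis
  define M where "M = Max (N ` {..Suc n})"
  define e where "e = (\<lambda>i. (singular_subdivision i ^^ M) (d i))"
  have e: "antipodal_tower (Suc n) X e"
    unfolding e_def by (rule antipodal_tower_subdivision[OF d])
  have "\<exists>a b. singular_chain i (subtopology X U) a \<and> singular_chain i (subtopology X U) b \<and>
      e i = a + chain_map i uminus b" if i: "i \<le> Suc n" for i
  proof -
    have "N i \<le> M" using i by (simp add: M_def)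
    then have small: "f \<in> standard_simplex i \<rightarrow> U \<or> f \<in> standard_simplex i \<rightarrow> V"
      if "f \<in> Poly_Mapping.keys (e i)" for f
      using N[OF i] that by (simp add: e_def)
    have "singular_chain i X (e i)"
      using e i by (simp add: antipodal_tower_def)
    then have "Poly_Mapping.keys (e i) \<subseteq>
        singular_simplex_set i (subtopology X U) \<union> singular_simplex_set i (subtopology X V)"
      using small by (fastforce simp: singular_chain_def singular_simplex_subtopology)
    then obtain a b' where ab: "Poly_Mapping.keys a \<subseteq> singular_simplex_set i (subtopology X U)"
      "Poly_Mapping.keys b' \<subseteq> singular_simplex_set i (subtopology X V)" "a + b' = e i"
      by (rule frag_split)
    then have b': "singular_chain i (subtopology X V) b'" by (simp add: singular_chain_def)
    show ?thesis
    proof (intro exI conjI)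
      show "singular_chain i (subtopology X U) a" using ab by (simp add: singular_chain_def)
      show "singular_chain i (subtopology X U) (chain_map i uminus b')"
        using b' mU by (rule singular_chain_chain_map)
      show "e i = a + chain_map i uminus (chain_map i uminus b')"
        using chain_map_uminus_uminus[OF b'] ab by simp
    qed
  qed
  then obtain a b where a: "\<And>i. i \<le> Suc n \<Longrightarrow> singular_chain i (subtopology X U) (a i)"
    and b: "\<And>i. i \<le> Suc n \<Longrightarrow> singular_chain i (subtopology X U) (b i)"
    and eab: "\<And>i. i \<le> Suc n \<Longrightarrow> e i = a i + chain_map i uminus (b i)"
    by metis
  define c where "c = (\<lambda>i. a i - frag_cmul ((-1) ^ i) (b i))"
  define w where "w = (\<lambda>i. c i - chain_boundary (Suc i) (b (Suc i)))"
  have c: "singular_chain i (subtopology X U) (c i)" if "i \<le> Suc n" for i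
    using a[OF that] b[OF that] by (simp add: c_def singular_chain_diff singular_chain_cmul)
  have ec: "e i = c i + chain_map i uminus (b i) + frag_cmul ((-1) ^ i) (b i)" if "i \<le> Suc n" for i
    using eab[OF that] by (simp add: c_def)
  have wU: "singular_chain i (subtopology X U) (w i)" if "i \<le> n" for i
    unfolding w_def using c[of i] b[of "Suc i"] that
    by (intro singular_chain_diff singular_chain_boundary_alt) auto
  have bc: "chain_boundary (Suc i) (c (Suc i)) =
      chain_map i uminus (w i) + frag_cmul ((-1) ^ Suc i) (w i)" if i: "i \<le> n" for i
  proof -
    let ?T = "chain_map i (uminus :: 'a \<Rightarrow> 'a)" and ?s = "frag_cmul ((-1) ^ i)"
    let ?B = "chain_boundary (Suc i) (b (Suc i))"
    have TT: "?T (?T (b i)) = b i"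
      using b[of i] i by (intro chain_map_uminus_uminus) auto
    have "chain_boundary (Suc i) (e (Suc i)) =
        chain_boundary (Suc i) (c (Suc i)) + ?T ?B - ?s ?B"
      using chain_boundary_chain_map[OF b[of "Suc i"], of uminus] i
      by (cases "even i")
        (simp_all add: ec chain_boundary_add chain_boundary_diff chain_boundary_minus)
    moreover have "chain_boundary (Suc i) (e (Suc i)) = ?T (e i) - ?s (e i)"
      using e i by (cases "even i") (simp_all add: antipodal_tower_def)
    moreover have "?T (e i) - ?s (e i) = ?T (c i) - ?s (c i)"
      using i TT by (cases "even i") (simp_all add: ec chain_map_add chain_map_diff chain_map_minus)
    ultimately have "chain_boundary (Suc i) (c (Suc i)) = ?T (c i) - ?s (c i) - ?T ?B + ?s ?B"
      by (simp add: algebra_simps)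
    then show ?thesis
      by (cases "even i") (simp_all add: w_def chain_map_diff)
  qed
  have TwU: "singular_chain i (subtopology X U) (chain_map i uminus (w i))" if i: "i \<le> n" for i
  proof -
    have "chain_map i uminus (w i) = chain_boundary (Suc i) (c (Suc i)) - frag_cmul ((-1) ^ Suc i) (w i)"
      using bc[OF i] by simp
    then show ?thesis
      using c[of "Suc i"] wU[OF i] i
      by (auto intro!: singular_chain_diff singular_chain_cmul singular_chain_boundary_alt
          simp del: minus_frag_cmul)
  qed
  have w: "singular_chain i (subtopology X {x. x \<in> U \<and> - x \<in> U}) (w i)" if i: "i \<le> n" for i
  proof -
    have "singular_chain i (subtopology X V) (chain_map i uminus (chain_map i uminus (w i)))"
      using TwU[OF i] mV by (rule singular_chain_chain_map)
    then have "singular_chain i (subtopology X V) (w i)"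
      using chain_map_uminus_uminus[OF wU[OF i]] by simp
    then show ?thesis
      using wU[OF i] by (fastforce simp: singular_chain_subtopology V_def image_subset_iff)
  qed
  have "antipodal_tower n (subtopology X {x. x \<in> U \<and> - x \<in> U}) w"
    unfolding antipodal_tower_def
  proof (intro conjI allI impI)
    fix i assume i: "i < n"
    have "chain_boundary (Suc i) (chain_boundary (Suc (Suc i)) (b (Suc (Suc i)))) = 0"
      using b[of "Suc (Suc i)"] i by (intro chain_boundary_boundary_alt) auto
    then show "chain_boundary (Suc i) (w (Suc i)) =
        chain_map i uminus (w i) + frag_cmul ((-1) ^ Suc i) (w i)"
      using bc[of i] i by (simp add: w_def chain_boundary_diff)
  next
    have "odd (augmentation (e 0))"
      using e by (simp add: antipodal_tower_def)
    \<comment> \<open>\<open>w 0\<close> differs from \<open>e 0\<close> by a boundary and by \<open>T (b 0) + b 0\<close>, whose augmentation is even.\<close>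
    then show "odd (augmentation (w 0))"
      by (simp add: w_def ec)
  qed (simp add: w)
  then show thesis by (rule that)
qed

lemma continuous_map_uminus_Euclidean_space:
  "continuous_map (subtopology (Euclidean_space n) S) (Euclidean_space n) uminus"
proof -
  have "continuous_map (subtopology (Euclidean_space n) S) (powertop_real UNIV) (\<lambda>x i. - x i)"
    by (auto simp: continuous_map_componentwise_UNIV Euclidean_space_def
        intro!: continuous_map_minus continuous_map_from_subtopology continuous_map_product_projection)
  then have "continuous_map (subtopology (Euclidean_space n) S) (powertop_real UNIV) uminus"
    by (simp add: fun_Compl_def[abs_def])
  then show ?thesis
    by (auto simp: Euclidean_space_def continuous_map_in_subtopology)
qed

text \<open>
  Each restriction lowers the dimension and the height together, down to the empty space, whose only
  chain has augmentation 0. The open half \<open>U\<close> is chosen to meet \<open>- U\<close> in the cone where the last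
  coordinate is smaller in absolute value than the sum of the others; there the last coordinate can
  be deleted without reaching the origin.
\<close>

lemma no_antipodal_tower_punctured_Euclidean_space:
  "\<not> antipodal_tower n (subtopology (Euclidean_space n) (- {0})) d"
proof (induction n arbitrary: d)
  case 0
  have "topspace (subtopology (Euclidean_space 0) (- {0})) = {}"
    by (auto simp: topspace_Euclidean_space fun_eq_iff)
  then show ?case
    unfolding antipodal_tower_def
    by (metis singular_chain_empty augmentation_simps(1) even_zero le_zero_eq)
next
  case (Suc n)
  show ?case
  proof
    let ?X = "subtopology (Euclidean_space (Suc n)) (- {0})"
    define U where "U = {x \<in> topspace ?X. x n + (\<Sum>i<n. \<bar>x i\<bar>) > 0}"
    let ?W = "subtopology ?X {x. x \<in> U \<and> - x \<in> U}"
    assume d: "antipodal_tower (Suc n) ?X d"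
    have proj: "continuous_map ?X euclideanreal (\<lambda>x. x i)" for i
      unfolding Euclidean_space_def
      by (intro continuous_map_from_subtopology continuous_map_product_projection) auto
    have "continuous_map ?X euclideanreal (\<lambda>x. x n + (\<Sum>i<n. \<bar>x i\<bar>))"
      by (intro continuous_map_add continuous_map_sum continuous_map_real_abs proj) auto
    then have "openin ?X {x \<in> topspace ?X. x n + (\<Sum>i<n. \<bar>x i\<bar>) \<in> {0<..}}"
      by (rule openin_continuous_map_preimage) auto
    then have U: "openin ?X U" by (simp add: U_def)
    have sym: "continuous_map ?X ?X uminus"
      using continuous_map_uminus_Euclidean_space[of "Suc n"]
      by (auto simp: continuous_map_in_subtopology)
    have cover: "x \<in> U \<or> - x \<in> U" if x: "x \<in> topspace ?X" for x
    proof -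
      have mx: "- x \<in> topspace ?X"
        using x by (auto simp: topspace_Euclidean_space)
      have nonneg: "(\<Sum>i<n. \<bar>x i\<bar>) \<ge> 0" by (simp add: sum_nonneg)
      have "x n + (\<Sum>i<n. \<bar>x i\<bar>) > 0 \<or> - x n + (\<Sum>i<n. \<bar>x i\<bar>) > 0"
      proof (rule ccontr)
        assume "\<not> ?thesis"
        then have "(\<Sum>i<n. \<bar>x i\<bar>) = 0" "x n = 0" using nonneg by linarith+
        then have "x i = 0" if "i < Suc n" for i
          using that by (auto simp: sum_nonneg_eq_0_iff less_Suc_eq)
        then have "x i = 0" for i
          using x by (cases "i < Suc n") (auto simp: topspace_Euclidean_space)
        then have "x = 0" by (simp add: fun_eq_iff)
        then show False using x by simp
      qed
      then show ?thesis using x mx by (auto simp: U_def)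
    qed
    obtain w where w: "antipodal_tower n ?W w"
      using antipodal_tower_restrict[OF d sym U cover] by blast
    define g where "g = (\<lambda>(x :: nat \<Rightarrow> real) i. if i < n then x i else 0)"
    have "continuous_map ?W (Euclidean_space n) g"
      unfolding g_def continuous_map_componentwise_Euclidean_space
      by (simp add: proj continuous_map_from_subtopology)
    moreover have "g x \<noteq> 0" if "x \<in> topspace ?W" for x
    proof
      assume "g x = 0"
      then have "x i = 0" if "i < n" for i
        using that by (metis g_def zero_fun_apply)
      then show False using that by (auto simp: U_def)
    qed
    ultimately have g: "continuous_map ?W (subtopology (Euclidean_space n) (- {0})) g"
      by (auto simp: continuous_map_in_subtopology)
    have "antipodal_tower n (subtopology (Euclidean_space n) (- {0})) (\<lambda>i. chain_map i g (w i))"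
      using w g by (rule antipodal_tower_chain_map) (auto simp: g_def fun_eq_iff)
    then show False using Suc by blast
  qed
qed

text \<open>
  Reduced homology in degree 0 is the kernel of the map induced by the projection to a point; this
  lemma puts 0-chains of augmentation 0 into that kernel.
\<close>

lemma augmentation_zero_imp_chain_map_point_zero:
  assumes "augmentation c = 0"
  shows "chain_map 0 (\<lambda>_. ()) c = 0"
proof -
  have "chain_map 0 (\<lambda>_. ()) c = frag_cmul (augmentation c) (frag_of (\<lambda>_. ()))"
    using subset_UNIV
    by (induction c rule: frag_induction) (auto simp: chain_map_diff frag_cmul_diff_distrib frag_of_eq fun_eq_iff)
  then show ?thesis using assms by simp
qed

text \<open>
  The reduced homology of the \<open>n\<close>-sphere vanishes below degree \<open>n\<close>.
\<close>

lemma cycle_imp_boundary_nsphere: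
  assumes pn: "p < n" and c: "singular_chain p (nsphere n) c"
    and cyc: "chain_boundary p c = 0" and aug: "p = 0 \<Longrightarrow> augmentation c = 0"
  shows "\<exists>e. singular_chain (Suc p) (nsphere n) e \<and> chain_boundary (Suc p) e = c"
proof -
  let ?X = "nsphere n" and ?P = "discrete_topology {()}"
  have cycle: "singular_relcycle p ?X {} c"
    using c cyc by (simp add: singular_cycle)
  have hom: "homologous_rel_set p ?X {} c \<in> carrier (homology_group (int p) ?X)"
    using cycle by (auto simp: carrier_relative_homology_group)
  have "homologous_rel_set p ?X {} c \<in> carrier (reduced_homology_group (int p) ?X)"
  proof (cases "p = 0")
    case False
    then show ?thesis using hom by (simp add: un_reduced_homology_group)
  next
    case True
    have "hom_induced (int p) ?X {} ?P {} (\<lambda>x. ()) (homologous_rel_set p ?X {} c) =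
        homologous_rel_set p ?P {} (chain_map p (\<lambda>x. ()) c)"
      using cycle by (intro hom_induced_chain_map) auto
    also have "\<dots> = singular_relboundary_set p ?P {}"
      using aug True augmentation_zero_imp_chain_map_point_zero[of c]
      by (simp add: homologous_rel_set_eq_relboundary)
    finally show ?thesis
      using hom by (auto simp: carrier_reduced_homology_group kernel_def)
  qed
  moreover have "trivial_group (reduced_homology_group (int p) ?X)"
    using pn by (simp add: trivial_reduced_homology_group_nsphere)
  ultimately have "homologous_rel_set p ?X {} c = singular_relboundary_set p ?X {}"
    by (auto simp: trivial_group_def one_reduced_homology_group)
  then show ?thesis
    by (simp add: homologous_rel_set_eq_relboundary singular_boundary)
qed

lemma continuous_map_uminus_nsphere: "continuous_map (nsphere n) (nsphere n) uminus"
  unfolding nsphere_def using continuous_map_uminus_Euclidean_space[of "Suc n"]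
  by (auto simp: continuous_map_in_subtopology)

text \<open>
  The right-hand side of the tower relation is always a cycle, and for \<open>i = 0\<close> it has augmentation 0,
  so the next chain can be found as long as cycles of that degree bound in the sphere.
\<close>

lemma antipodal_tower_nsphere: "k \<le> n \<Longrightarrow> \<exists>d. antipodal_tower k (nsphere n) d"
proof (induction k)
  case 0
  obtain x where x: "x \<in> topspace (nsphere n)"
    using in_topspace_nsphere by blast
  have "singular_simplex 0 (nsphere n) (restrict (\<lambda>_. x) (standard_simplex 0))"
    using x by (auto simp: singular_simplex_def)
  then have "antipodal_tower 0 (nsphere n) (\<lambda>_. frag_of (restrict (\<lambda>_. x) (standard_simplex 0)))"
    by (simp add: antipodal_tower_def singular_chain_of)
  then show ?case by blast
next
  case (Suc k)
  let ?X = "nsphere n"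
  obtain d where d: "antipodal_tower k ?X d"
    using Suc by auto
  have sing: "singular_chain i ?X (d i)" if "i \<le> k" for i
    using d that by (simp add: antipodal_tower_def)
  define z where "z = chain_map k uminus (d k) + frag_cmul ((-1) ^ Suc k) (d k)"
  have z: "singular_chain k ?X z"
    unfolding z_def using sing[of k] singular_chain_chain_map[OF _ continuous_map_uminus_nsphere]
    by (intro singular_chain_add singular_chain_cmul) auto
  have "chain_boundary k z = 0"
  proof (cases k)
    case 0
    then show ?thesis by (simp add: chain_boundary_def)
  next
    case (Suc j)
    have bd: "chain_boundary k (d k) = chain_map j uminus (d j) + frag_cmul ((-1) ^ k) (d j)"
      using d Suc by (simp add: antipodal_tower_def)
    have TT: "chain_map j uminus (chain_map j uminus (d j)) = d j"
      using sing[of j] Suc by (intro chain_map_uminus_uminus) auto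
    have "chain_boundary k z = chain_map j uminus (chain_boundary k (d k)) +
        frag_cmul ((-1) ^ Suc k) (chain_boundary k (d k))"
      using chain_boundary_chain_map[OF sing[of k], of uminus] Suc
      by (simp add: z_def chain_boundary_add chain_boundary_cmul)
    also have "\<dots> = 0"
      unfolding bd using TT by (cases "even k") (simp_all add: chain_map_add chain_map_diff chain_map_minus)
    finally show ?thesis .
  qed
  moreover have "augmentation z = 0" if "k = 0"
    using that by (simp add: z_def)
  ultimately obtain e where e: "singular_chain (Suc k) ?X e" "chain_boundary (Suc k) e = z"
    using cycle_imp_boundary_nsphere[of k n z] z Suc.prems by auto
  have "antipodal_tower (Suc k) ?X (d(Suc k := e))"
    using d e by (auto simp: antipodal_tower_def z_def le_Suc_eq less_Suc_eq)
  then show ?case by blast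
qed

text \<open>
  An odd map without zeros would carry a tower of height \<open>m\<close> on the sphere into the punctured
  \<open>m\<close>-dimensional space.
\<close>

theorem Borsuk_Ulam:
  assumes f: "continuous_map (nsphere n) (Euclidean_space m) f" and "m \<le> n"
    and odd: "\<And>x. x \<in> topspace (nsphere n) \<Longrightarrow> f (- x) = - f x"
  shows "\<exists>x\<in>topspace (nsphere n). f x = 0"
proof (rule ccontr)
  assume "\<not> ?thesis"
  then have f': "continuous_map (nsphere n) (subtopology (Euclidean_space m) (- {0})) f"
    using f by (auto simp: continuous_map_in_subtopology)
  obtain d where d: "antipodal_tower m (nsphere n) d"
    using antipodal_tower_nsphere[OF \<open>m \<le> n\<close>] by blast
  have "antipodal_tower m (subtopology (Euclidean_space m) (- {0})) (\<lambda>i. chain_map i f (d i))"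
    using antipodal_tower_chain_map[OF d f'] odd by blast
  then show False
    using no_antipodal_tower_punctured_Euclidean_space by blast
qed

lemma enat_le_genus_if_odd_map_from_nsphere:
  assumes g: "continuous_map (nsphere k) (subtopology (norm_topology X nrm) A) g"
    and odd: "\<And>x. x \<in> topspace (nsphere k) \<Longrightarrow> g (- x) = - g x"
  shows "enat (Suc k) \<le> genus X nrm A"
  unfolding genus_def
proof (rule Inf_greatest)
  fix N assume "N \<in> {enat n | n. \<exists>\<zeta> :: 'a \<Rightarrow> nat \<Rightarrow> real.
        continuous_map (subtopology (norm_topology X nrm) A) (Euclidean_space n) \<zeta> \<and>
        (\<forall>x\<in>A. \<zeta> x \<noteq> 0) \<and> (\<forall>x\<in>A. \<zeta> (- x) = - \<zeta> x)}"
  then obtain n and \<zeta> :: "'a \<Rightarrow> nat \<Rightarrow> real" where N: "N = enat n"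
    and z: "continuous_map (subtopology (norm_topology X nrm) A) (Euclidean_space n) \<zeta>"
    and nz: "\<And>x. x \<in> A \<Longrightarrow> \<zeta> x \<noteq> 0" and zodd: "\<And>x. x \<in> A \<Longrightarrow> \<zeta> (- x) = - \<zeta> x"
    by blast
  have gA: "g x \<in> A" if "x \<in> topspace (nsphere k)" for x
    using g that by (auto simp: continuous_map_in_subtopology)
  have "\<not> n \<le> k"
  proof
    assume "n \<le> k"
    then obtain x where "x \<in> topspace (nsphere k)" "(\<zeta> \<circ> g) x = 0"
      using Borsuk_Ulam[OF continuous_map_compose[OF g z]] odd zodd gA by auto
    then show False using nz gA by auto
  qed
  then show "enat (Suc k) \<le> N" by (simp add: N)
qed

section \<open>A weighted space of square summable sequences\<close>

text \<open>
  The ratio \<open>1 / 4\<close> is small enough for one weight to exceed twice the sum of all later ones, which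
  \<open>leading_term_dominates\<close> turns into the absence of critical points.
\<close>

definition wt :: "nat \<Rightarrow> real" where
  "wt i = (1 / 4) ^ i"

definition ell2 :: "(nat \<Rightarrow> real) set" where
  "ell2 = {u. summable (\<lambda>i. wt i * (u i)\<^sup>2)}"

definition ip :: "(nat \<Rightarrow> real) \<Rightarrow> (nat \<Rightarrow> real) \<Rightarrow> real" where
  "ip u v = (suminf (\<lambda>i. wt i * (u i * v i)))"

definition wnorm :: "(nat \<Rightarrow> real) \<Rightarrow> real" where
  "wnorm u = sqrt (ip u u)"

lemma wt_pos [simp]: "0 < wt i" and wt_nonneg [simp]: "0 \<le> wt i" and wt_0 [simp]: "wt 0 = 1"
  by (simp_all add: wt_def)

lemma wt_neq_0 [simp]: "wt i \<noteq> 0"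
  by (simp add: wt_def)

lemma wt_Suc: "wt (Suc i) = wt i / 4"
  by (simp add: wt_def)

lemma sums_wt_tail: "(\<lambda>i. wt (k + i)) sums (4 / 3 * wt k)"
  using sums_mult[OF geometric_sums[of "1 / 4 :: real"], of "wt k"]
  by (simp add: wt_def power_add mult.commute)

lemma summable_wt [simp]: "summable wt" and summable_wt_Suc [simp]: "summable (\<lambda>i. wt (Suc i))"
  and suminf_wt_Suc [simp]: "(suminf (\<lambda>i. wt (Suc i))) = 1 / 3"
  using sums_wt_tail[of 0] sums_wt_tail[of 1] by (auto simp: sums_iff wt_Suc)

lemma ell2_summable: "u \<in> ell2 \<Longrightarrow> summable (\<lambda>i. wt i * (u i)\<^sup>2)"
  by (simp add: ell2_def)

lemma ell2_dominated:
  assumes v: "v \<in> ell2" and le: "\<And>i. \<bar>u i\<bar> \<le> \<bar>v i\<bar>"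
  shows "u \<in> ell2"
proof -
  have "(u i)\<^sup>2 \<le> (v i)\<^sup>2" for i
    using le[of i] by (simp add: abs_le_square_iff)
  then show ?thesis
    using summable_comparison_test'[of "\<lambda>i. wt i * (v i)\<^sup>2" 0 "\<lambda>i. wt i * (u i)\<^sup>2"] v
    by (simp add: ell2_def mult_left_mono)
qed

lemma ell2_const [simp]: "(\<lambda>_. c) \<in> ell2"
  by (simp add: ell2_def summable_mult2)

lemma ell2_add: "u \<in> ell2 \<Longrightarrow> v \<in> ell2 \<Longrightarrow> u + v \<in> ell2"
proof -
  assume u: "u \<in> ell2" and v: "v \<in> ell2"
  have "summable (\<lambda>i. 2 * (wt i * (u i)\<^sup>2) + 2 * (wt i * (v i)\<^sup>2))"
    by (intro summable_add summable_mult ell2_summable u v)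
  moreover have "wt i * ((u + v) i)\<^sup>2 \<le> 2 * (wt i * (u i)\<^sup>2) + 2 * (wt i * (v i)\<^sup>2)" for i
  proof -
    have "(u i + v i)\<^sup>2 \<le> 2 * (u i)\<^sup>2 + 2 * (v i)\<^sup>2"
      using sum_squares_bound[of "u i" "v i"] by (simp add: power2_sum)
    then show ?thesis
      using mult_left_mono[OF _ wt_nonneg[of i], of "(u i + v i)\<^sup>2" "2 * (u i)\<^sup>2 + 2 * (v i)\<^sup>2"]
      by (simp add: algebra_simps)
  qed
  ultimately show ?thesis
    using summable_comparison_test'[of "\<lambda>i. 2 * (wt i * (u i)\<^sup>2) + 2 * (wt i * (v i)\<^sup>2)" 0
        "\<lambda>i. wt i * ((u + v) i)\<^sup>2"]
    by (simp add: ell2_def)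
qed

lemma ell2_scaleR: "u \<in> ell2 \<Longrightarrow> c *\<^sub>R u \<in> ell2"
  using summable_mult[of "\<lambda>i. wt i * (u i)\<^sup>2" "c\<^sup>2"]
  by (simp add: ell2_def scaleR_fun_def power_mult_distrib mult_ac)

lemma subspace_ell2: "subspace ell2"
  using ell2_const[of 0] by (auto simp: subspace_def ell2_add ell2_scaleR zero_fun_def)

lemmas ell2_diff = subspace_diff[OF subspace_ell2]
lemmas ell2_0 = subspace_0[OF subspace_ell2]

lemma ell2_abs: "u \<in> ell2 \<Longrightarrow> (\<lambda>i. \<bar>u i\<bar>) \<in> ell2"
  by (rule ell2_dominated) auto

lemma ip_summable:
  assumes "u \<in> ell2" "v \<in> ell2"
  shows "summable (\<lambda>i. wt i * (u i * v i))"
proof (rule summable_comparison_test')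
  show "summable (\<lambda>i. wt i * (u i)\<^sup>2 + wt i * (v i)\<^sup>2)"
    by (intro summable_add ell2_summable assms)
  fix i :: nat
  have "2 * \<bar>u i * v i\<bar> \<le> (u i)\<^sup>2 + (v i)\<^sup>2"
    using sum_squares_bound[of "\<bar>u i\<bar>" "\<bar>v i\<bar>"] by (simp add: abs_mult)
  then have "\<bar>u i * v i\<bar> \<le> (u i)\<^sup>2 + (v i)\<^sup>2"
    using abs_ge_zero[of "u i * v i"] by linarith
  then have "wt i * \<bar>u i * v i\<bar> \<le> wt i * ((u i)\<^sup>2 + (v i)\<^sup>2)"
    by (rule mult_left_mono) simp
  then show "norm (wt i * (u i * v i)) \<le> wt i * (u i)\<^sup>2 + wt i * (v i)\<^sup>2"
    by (simp add: abs_mult distrib_left)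
qed

lemma ip_commute: "ip u v = ip v u"
  by (simp add: ip_def mult.commute)

lemma ip_0_right [simp]: "ip u 0 = 0"
  by (simp add: ip_def)

lemma ip_add_left: "u \<in> ell2 \<Longrightarrow> v \<in> ell2 \<Longrightarrow> w \<in> ell2 \<Longrightarrow> ip (u + v) w = ip u w + ip v w"
  by (simp add: ip_def suminf_add ip_summable algebra_simps)

lemma ip_scaleR_left: "u \<in> ell2 \<Longrightarrow> v \<in> ell2 \<Longrightarrow> ip (c *\<^sub>R u) v = c * ip u v"
  by (simp add: ip_def suminf_mult[OF ip_summable, symmetric] scaleR_fun_def algebra_simps)

lemma ip_diff_left: "u \<in> ell2 \<Longrightarrow> v \<in> ell2 \<Longrightarrow> w \<in> ell2 \<Longrightarrow> ip (u - v) w = ip u w - ip v w"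
  using ip_add_left[of u "(-1) *\<^sub>R v" w] ip_scaleR_left[of v w "-1"] ell2_scaleR[of v "-1"] by simp

lemma ip_add_right: "u \<in> ell2 \<Longrightarrow> v \<in> ell2 \<Longrightarrow> w \<in> ell2 \<Longrightarrow> ip w (u + v) = ip w u + ip w v"
  using ip_add_left by (simp add: ip_commute)

lemma ip_scaleR_right: "u \<in> ell2 \<Longrightarrow> v \<in> ell2 \<Longrightarrow> ip v (c *\<^sub>R u) = c * ip v u"
  using ip_scaleR_left by (simp add: ip_commute)

lemma ip_diff_right: "u \<in> ell2 \<Longrightarrow> v \<in> ell2 \<Longrightarrow> w \<in> ell2 \<Longrightarrow> ip w (u - v) = ip w u - ip w v"
  using ip_diff_left by (simp add: ip_commute)

lemma ip_self_nonneg: "u \<in> ell2 \<Longrightarrow> 0 \<le> ip u u"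
  unfolding ip_def by (intro suminf_nonneg ip_summable) auto

lemma wnorm_nonneg: "u \<in> ell2 \<Longrightarrow> 0 \<le> wnorm u"
  by (simp add: wnorm_def ip_self_nonneg)

lemma wnorm_power2: "u \<in> ell2 \<Longrightarrow> (wnorm u)\<^sup>2 = (suminf (\<lambda>i. wt i * (u i)\<^sup>2))"
  using ip_self_nonneg[of u] by (simp add: wnorm_def ip_def power2_eq_square)

lemma ip_self: "u \<in> ell2 \<Longrightarrow> ip u u = (wnorm u)\<^sup>2"
  by (simp add: wnorm_def ip_self_nonneg)

lemma wnorm_eq_0_iff: "u \<in> ell2 \<Longrightarrow> wnorm u = 0 \<longleftrightarrow> u = 0"
  using suminf_eq_zero_iff[OF ip_summable[of u u]] by (auto simp: wnorm_def ip_def fun_eq_iff)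

lemma wnorm_0 [simp]: "wnorm 0 = 0"
  by (simp add: wnorm_def ip_def)

lemma coordinate_le_wnorm: "u \<in> ell2 \<Longrightarrow> wt i * (u i)\<^sup>2 \<le> (wnorm u)\<^sup>2"
  using sum_le_suminf[OF ell2_summable, of u "{i}"] by (simp add: wnorm_power2)

text \<open>
  The usual argument: expand the square of \<open>\<parallel>v\<parallel> u - \<parallel>u\<parallel> v\<close>.
\<close>

lemma Cauchy_Schwarz_ip:
  assumes u: "u \<in> ell2" and v: "v \<in> ell2"
  shows "\<bar>ip u v\<bar> \<le> wnorm u * wnorm v"
proof -
  have *: "ip u v \<le> wnorm u * wnorm v" if u: "u \<in> ell2" for u
  proof (cases "wnorm u = 0 \<or> wnorm v = 0")
    case True
    then have "ip u v = 0" using u v by (auto simp: wnorm_eq_0_iff ip_def)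
    then show ?thesis using u v by (simp add: wnorm_nonneg)
  next
    case False
    define a b where "a = wnorm u" and "b = wnorm v"
    have pos: "0 < a" "0 < b" using False u v wnorm_nonneg by (auto simp: a_def b_def less_le)
    have "0 \<le> ip (b *\<^sub>R u - a *\<^sub>R v) (b *\<^sub>R u - a *\<^sub>R v)"
      by (intro ip_self_nonneg ell2_diff ell2_scaleR u v)
    also have "\<dots> = 2 * (a * b) * (a * b - ip u v)"
      using u v by (simp add: ip_diff_left ip_diff_right ip_scaleR_left ip_scaleR_right ell2_scaleR
          ell2_diff ip_self[OF u] ip_self[OF v] ip_commute[of v u] a_def[symmetric] b_def[symmetric]
          power2_eq_square algebra_simps)
    finally show ?thesis
      using pos by (simp add: zero_le_mult_iff mult_le_0_iff a_def b_def)
  qed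
  have "ip ((-1) *\<^sub>R u) v = - ip u v" "wnorm ((-1) *\<^sub>R u) = wnorm u"
    using ip_scaleR_left[OF u v, of "-1"] by (simp_all add: wnorm_def ip_def scaleR_fun_def)
  then show ?thesis
    using *[OF u] *[OF ell2_scaleR[OF u, of "-1"]] by simp
qed

lemma wnorm_scaleR: "u \<in> ell2 \<Longrightarrow> wnorm (c *\<^sub>R u) = \<bar>c\<bar> * wnorm u"
  by (simp add: wnorm_def ip_scaleR_left ip_scaleR_right ell2_scaleR real_sqrt_mult flip: mult.assoc)

lemma wnorm_triangle:
  assumes u: "u \<in> ell2" and v: "v \<in> ell2"
  shows "wnorm (u + v) \<le> wnorm u + wnorm v"
proof (rule power2_le_imp_le)
  have "(wnorm (u + v))\<^sup>2 = (wnorm u)\<^sup>2 + 2 * ip u v + (wnorm v)\<^sup>2"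
    using u v by (simp add: ip_self[symmetric] ell2_add ip_add_left ip_add_right ip_commute[of v u])
  then show "(wnorm (u + v))\<^sup>2 \<le> (wnorm u + wnorm v)\<^sup>2"
    using Cauchy_Schwarz_ip[OF u v] by (simp add: power2_sum)
qed (simp add: wnorm_nonneg u v)

lemma normed_space_ell2: "normed_space_on ell2 wnorm"
  unfolding normed_space_on_def
  using subspace_ell2 wnorm_nonneg wnorm_eq_0_iff wnorm_scaleR wnorm_triangle by blast

interpretation ell2: Metric_space ell2 "norm_dist ell2 wnorm"
  by (rule Metric_space_norm_dist[OF normed_space_ell2])

lemma wnorm_mono:
  assumes v: "v \<in> ell2" and le: "\<And>i. \<bar>u i\<bar> \<le> \<bar>v i\<bar>"
  shows "wnorm u \<le> wnorm v"
proof (rule power2_le_imp_le)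
  have u: "u \<in> ell2" using assms by (rule ell2_dominated)
  show "(wnorm u)\<^sup>2 \<le> (wnorm v)\<^sup>2"
    unfolding wnorm_power2[OF u] wnorm_power2[OF v]
    using le by (intro suminf_le mult_left_mono ell2_summable u v) (auto simp: abs_le_square_iff)
qed (simp add: wnorm_nonneg v)

lemma limitin_ell2_iff:
  assumes "\<And>j. u j \<in> ell2"
  shows "limitin (norm_topology ell2 wnorm) u l sequentially \<longleftrightarrow>
    l \<in> ell2 \<and> (\<lambda>j. wnorm (u j - l)) \<longlonglongrightarrow> 0"
  using assms
  by (auto simp: norm_topology_def ell2.limitin_metric_dist_null norm_dist_def)

lemma ell2_partial_sums_bounded:
  assumes "\<And>k. (\<Sum>i<k. wt i * (u i)\<^sup>2) \<le> c\<^sup>2" and "0 \<le> c"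
  shows "u \<in> ell2" and "wnorm u \<le> c"
proof -
  show u: "u \<in> ell2"
    unfolding ell2_def using summableI_nonneg_bounded[OF _ assms(1)] by simp
  show "wnorm u \<le> c"
    using suminf_le_const[OF ell2_summable[OF u] assms(1)] power2_le_imp_le[OF _ assms(2), of "wnorm u"]
    by (simp add: wnorm_power2[OF u])
qed

lemma sum_le_wnorm: "u \<in> ell2 \<Longrightarrow> (\<Sum>i<k. wt i * (u i)\<^sup>2) \<le> (wnorm u)\<^sup>2"
  using sum_le_suminf[OF ell2_summable, of u "{..<k}"] by (simp add: wnorm_power2)

text \<open>
  A Cauchy sequence converges coordinatewise, and a Cauchy estimate for finite partial sums survives
  the passage to the coordinatewise limit.
\<close>

lemma banach_space_ell2: "banach_space_on ell2 wnorm"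
proof -
  have "\<exists>l. limitin ell2.mtopology \<sigma> l sequentially" if "ell2.MCauchy \<sigma>" for \<sigma>
  proof -
    have mem: "\<sigma> n \<in> ell2" for n
      using that by (auto simp: ell2.MCauchy_def)
    have cau: "\<exists>N. \<forall>m\<ge>N. \<forall>n\<ge>N. wnorm (\<sigma> m - \<sigma> n) < \<epsilon>" if "\<epsilon> > 0" for \<epsilon>
      using \<open>ell2.MCauchy \<sigma>\<close> that mem by (auto simp: ell2.MCauchy_def norm_dist_def)
    have "Cauchy (\<lambda>n. \<sigma> n i)" for i
    proof (rule metric_CauchyI)
      fix e :: real assume "e > 0"
      then have "sqrt (wt i) * e > 0" by simp
      then obtain N where N: "\<And>m n. m \<ge> N \<Longrightarrow> n \<ge> N \<Longrightarrow> wnorm (\<sigma> m - \<sigma> n) < sqrt (wt i) * e"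
        using cau by blast
      have "dist (\<sigma> m i) (\<sigma> n i) < e" if "m \<ge> N" "n \<ge> N" for m n
      proof -
        have d: "\<sigma> m - \<sigma> n \<in> ell2" using mem by (simp add: ell2_diff)
        have "wt i * (\<sigma> m i - \<sigma> n i)\<^sup>2 \<le> (wnorm (\<sigma> m - \<sigma> n))\<^sup>2"
          using coordinate_le_wnorm[OF d, of i] by simp
        also have "\<dots> < (sqrt (wt i) * e)\<^sup>2"
          using N[OF that] wnorm_nonneg[OF d] by (intro power_strict_mono) auto
        finally have "wt i * (\<sigma> m i - \<sigma> n i)\<^sup>2 < wt i * e\<^sup>2"
          by (simp add: power_mult_distrib)
        then have "(\<sigma> m i - \<sigma> n i)\<^sup>2 < e\<^sup>2" by simp
        then show ?thesis
          using \<open>e > 0\<close> power2_less_imp_less[of "\<bar>\<sigma> m i - \<sigma> n i\<bar>" e] by (simp add: dist_real_def)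
      qed
      then show "\<exists>N. \<forall>m\<ge>N. \<forall>n\<ge>N. dist (\<sigma> m i) (\<sigma> n i) < e" by blast
    qed
    then have "\<exists>x. (\<lambda>n. \<sigma> n i) \<longlonglongrightarrow> x" for i
      by (simp add: Cauchy_convergent_iff convergent_def)
    then obtain l where l: "\<And>i. (\<lambda>n. \<sigma> n i) \<longlonglongrightarrow> l i" by metis
    have near: "\<sigma> m - l \<in> ell2 \<and> wnorm (\<sigma> m - l) \<le> \<epsilon>"
      if e: "\<epsilon> > 0" and N: "\<And>n. n \<ge> N \<Longrightarrow> wnorm (\<sigma> m - \<sigma> n) < \<epsilon>" for m N \<epsilon>
    proof -
      have "(\<Sum>i<k. wt i * ((\<sigma> m - l) i)\<^sup>2) \<le> \<epsilon>\<^sup>2" for k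
      proof (rule LIMSEQ_le_const2)
        show "(\<lambda>n. \<Sum>i<k. wt i * ((\<sigma> m - \<sigma> n) i)\<^sup>2) \<longlonglongrightarrow> (\<Sum>i<k. wt i * ((\<sigma> m - l) i)\<^sup>2)"
          using l by (auto intro!: tendsto_intros)
        have "(\<Sum>i<k. wt i * ((\<sigma> m - \<sigma> n) i)\<^sup>2) \<le> \<epsilon>\<^sup>2" if "n \<ge> N" for n
        proof -
          have d: "\<sigma> m - \<sigma> n \<in> ell2" using mem by (simp add: ell2_diff)
          have "(wnorm (\<sigma> m - \<sigma> n))\<^sup>2 \<le> \<epsilon>\<^sup>2"
            using N[OF that] wnorm_nonneg[OF d] by (intro power_mono) auto
          then show ?thesis using sum_le_wnorm[OF d, of k] by linarith
        qed
        then show "\<exists>N. \<forall>n\<ge>N. (\<Sum>i<k. wt i * ((\<sigma> m - \<sigma> n) i)\<^sup>2) \<le> \<epsilon>\<^sup>2" by blast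
      qed
      then show ?thesis using ell2_partial_sums_bounded[of "\<sigma> m - l" \<epsilon>] e by simp
    qed
    obtain N where "\<And>n. n \<ge> N \<Longrightarrow> wnorm (\<sigma> N - \<sigma> n) < 1"
      using cau[of 1] by force
    then have "\<sigma> N - l \<in> ell2" using near[of 1 N N] by simp
    moreover have "l = \<sigma> N - (\<sigma> N - l)" by simp
    ultimately have lmem: "l \<in> ell2" using mem ell2_diff by metis
    have "(\<lambda>j. wnorm (\<sigma> j - l)) \<longlonglongrightarrow> 0"
    proof (rule LIMSEQ_I)
      fix r :: real assume "r > 0"
      then obtain N where N: "\<And>m n. m \<ge> N \<Longrightarrow> n \<ge> N \<Longrightarrow> wnorm (\<sigma> m - \<sigma> n) < r / 2"
        using cau[of "r / 2"] by auto
      have "norm (wnorm (\<sigma> m - l) - 0) < r" if "m \<ge> N" for m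
        using near[of "r / 2" N m] N[OF that] \<open>r > 0\<close> wnorm_nonneg[of "\<sigma> m - l"] by auto
      then show "\<exists>N. \<forall>m\<ge>N. norm (wnorm (\<sigma> m - l) - 0) < r" by blast
    qed
    then show ?thesis
      using limitin_ell2_iff[of \<sigma> l] mem lmem by (auto simp: norm_topology_def)
  qed
  then show ?thesis
    by (simp add: banach_space_on_def normed_space_ell2 ell2.mcomplete_def)
qed

text \<open>
  The functional represented by \<open>g\<close>, with the value 0 outside the space that elements of
  \<^const>\<open>dual_space\<close> are required to have.
\<close>

definition riesz :: "(nat \<Rightarrow> real) \<Rightarrow> (nat \<Rightarrow> real) \<Rightarrow> real" where
  "riesz g h = (if h \<in> ell2 then ip g h else 0)"

lemma riesz_dual_space: "g \<in> ell2 \<Longrightarrow> riesz g \<in> dual_space ell2 wnorm"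
  using Cauchy_Schwarz_ip[of g]
  by (auto simp: dual_space_def riesz_def ip_add_right ip_scaleR_right ell2_add ell2_scaleR)

lemma riesz_diff: "g \<in> ell2 \<Longrightarrow> g' \<in> ell2 \<Longrightarrow> riesz g - riesz g' = riesz (g - g')"
  by (auto simp: riesz_def fun_eq_iff ip_diff_left)

lemma riesz_eq_0_iff: "g \<in> ell2 \<Longrightarrow> riesz g = 0 \<longleftrightarrow> g = 0"
proof
  assume g: "g \<in> ell2" and "riesz g = 0"
  then have "riesz g g = 0" by simp
  then show "g = 0" using g by (simp add: riesz_def ip_self wnorm_eq_0_iff)
qed (auto simp: riesz_def fun_eq_iff ip_def)

lemma dual_norm_riesz:
  assumes g: "g \<in> ell2"
  shows "dual_norm ell2 wnorm (riesz g) = wnorm g"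
  unfolding dual_norm_def
proof (rule cSup_eq_maximum)
  have bound: "\<bar>riesz g h\<bar> \<le> wnorm g" if "h \<in> ell2" "wnorm h \<le> 1" for h
    using Cauchy_Schwarz_ip[OF g that(1)] mult_left_mono[OF that(2) wnorm_nonneg[OF g]] that(1)
    by (simp add: riesz_def)
  show "x \<le> wnorm g" if "x \<in> (\<lambda>h. \<bar>riesz g h\<bar>) ` {h \<in> ell2. wnorm h \<le> 1}" for x
    using that bound by auto
  show "wnorm g \<in> (\<lambda>h. \<bar>riesz g h\<bar>) ` {h \<in> ell2. wnorm h \<le> 1}"
  proof (rule image_eqI)
    let ?h = "inverse (wnorm g) *\<^sub>R g"
    show "?h \<in> {h \<in> ell2. wnorm h \<le> 1}"
      using g wnorm_nonneg[OF g] by (cases "wnorm g = 0") (auto simp: ell2_scaleR wnorm_scaleR ell2_0)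
    show "wnorm g = \<bar>riesz g ?h\<bar>"
      using g wnorm_nonneg[OF g]
      by (cases "wnorm g = 0")
        (auto simp: riesz_def ell2_scaleR ip_scaleR_right ip_self power2_eq_square abs_mult)
  qed
qed

lemma frechet_derivative_on_eqI:
  assumes "has_frechet_derivative_on ell2 wnorm I \<phi> u"
  shows "frechet_derivative_on ell2 wnorm I u = \<phi>"
  unfolding frechet_derivative_on_def
  using assms has_frechet_derivative_on_unique[OF normed_space_ell2 _ assms] by blast

text \<open>
  Derivatives are handled through gradients for the weighted inner product. A quadratic Taylor bound
  gives differentiability, and a Lipschitz bound for the gradient at each point its continuity.
\<close>

lemma gradient_imp_C1:
  assumes G: "\<And>u. u \<in> ell2 \<Longrightarrow> G u \<in> ell2"
    and taylor: "\<And>u. u \<in> ell2 \<Longrightarrow> \<exists>K. \<forall>h\<in>ell2. \<bar>I (u + h) - I u - ip (G u) h\<bar> \<le> K * (wnorm h)\<^sup>2"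
    and cont: "\<And>u. u \<in> ell2 \<Longrightarrow>
      \<exists>K. \<forall>h\<in>ell2. wnorm (G (u + h) - G u) \<le> K * wnorm h"
  shows "C1_functional_on ell2 wnorm I"
    and "u \<in> ell2 \<Longrightarrow> frechet_derivative_on ell2 wnorm I u = riesz (G u)"
proof -
  have der: "has_frechet_derivative_on ell2 wnorm I (riesz (G u)) u" if u: "u \<in> ell2" for u
    unfolding has_frechet_derivative_on_def
  proof (intro conjI allI impI)
    show "riesz (G u) \<in> dual_space ell2 wnorm" by (rule riesz_dual_space[OF G[OF u]])
    obtain K where K: "\<And>h. h \<in> ell2 \<Longrightarrow> \<bar>I (u + h) - I u - ip (G u) h\<bar> \<le> K * (wnorm h)\<^sup>2"
      using taylor[OF u] by blast
    fix \<epsilon> :: real assume e: "\<epsilon> > 0"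
    have "\<bar>I (u + h) - I u - riesz (G u) h\<bar> \<le> \<epsilon> * wnorm h"
      if h: "h \<in> ell2" and small: "wnorm h < \<epsilon> / (\<bar>K\<bar> + 1)" for h
    proof -
      have "K * wnorm h \<le> (\<bar>K\<bar> + 1) * wnorm h"
        using wnorm_nonneg[OF h] by (intro mult_right_mono) auto
      also have "\<dots> \<le> \<epsilon>" using small by (simp add: field_simps add_pos_nonneg)
      finally have "K * wnorm h * wnorm h \<le> \<epsilon> * wnorm h"
        using wnorm_nonneg[OF h] by (rule mult_right_mono)
      then show ?thesis using K[OF h] h by (simp add: riesz_def power2_eq_square mult.assoc)
    qed
    then show "\<exists>\<delta>>0. \<forall>h\<in>ell2. wnorm h < \<delta> \<longrightarrow> \<bar>I (u + h) - I u - riesz (G u) h\<bar> \<le> \<epsilon> * wnorm h"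
      using e by (intro exI[of _ "\<epsilon> / (\<bar>K\<bar> + 1)"]) (auto simp: add_nonneg_pos)
  qed
  show fd: "frechet_derivative_on ell2 wnorm I u = riesz (G u)" if "u \<in> ell2" for u
    by (rule frechet_derivative_on_eqI[OF der[OF that]])
  show "C1_functional_on ell2 wnorm I"
    unfolding C1_functional_on_def
  proof (intro conjI ballI allI impI)
    show "\<exists>\<phi>. has_frechet_derivative_on ell2 wnorm I \<phi> u" if "u \<in> ell2" for u
      using der[OF that] by blast
    fix u \<epsilon> assume u: "u \<in> ell2" and e: "(\<epsilon>::real) > 0"
    obtain K where K: "\<And>h. h \<in> ell2 \<Longrightarrow> wnorm (G (u + h) - G u) \<le> K * wnorm h"
      using cont[OF u] by blast
    have "dual_norm ell2 wnorm (frechet_derivative_on ell2 wnorm I v - frechet_derivative_on ell2 wnorm I u) < \<epsilon>"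
      if v: "v \<in> ell2" and small: "wnorm (v - u) < \<epsilon> / (\<bar>K\<bar> + 1)" for v
    proof -
      have d: "v - u \<in> ell2" using u v by (simp add: ell2_diff)
      have "dual_norm ell2 wnorm (frechet_derivative_on ell2 wnorm I v - frechet_derivative_on ell2 wnorm I u)
          = wnorm (G v - G u)"
        using u v by (simp add: fd riesz_diff G dual_norm_riesz ell2_diff)
      also have "\<dots> \<le> K * wnorm (v - u)"
        using K[OF d] by simp
      also have "\<dots> \<le> (\<bar>K\<bar> + 1) * wnorm (v - u)"
        using wnorm_nonneg[OF d] by (intro mult_right_mono) auto
      also have "\<dots> < \<epsilon>" using small by (simp add: field_simps add_pos_nonneg)
      finally show ?thesis .
    qed
    then show "\<exists>\<delta>>0. \<forall>v\<in>ell2. wnorm (v - u) < \<delta> \<longrightarrow>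
        dual_norm ell2 wnorm (frechet_derivative_on ell2 wnorm I v - frechet_derivative_on ell2 wnorm I u) < \<epsilon>"
      using e by (intro exI[of _ "\<epsilon> / (\<bar>K\<bar> + 1)"]) (auto simp: add_nonneg_pos)
  qed
qed

text \<open>
  Tychonoff's theorem; the product topology on real sequences is metrizable, so compactness yields
  subsequences.
\<close>

lemma bounded_coordinates_convergent_subseq:
  fixes u :: "nat \<Rightarrow> nat \<Rightarrow> real"
  assumes "\<And>j i. \<bar>u j i\<bar> \<le> K i"
  shows "\<exists>r l. strict_mono (r :: nat \<Rightarrow> nat) \<and> (\<forall>i. (\<lambda>j. u (r j) i) \<longlonglongrightarrow> l i)"
proof -
  have "compactin (product_topology (\<lambda>_. euclidean) UNIV) (PiE UNIV (\<lambda>i. {- K i..K i}))"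
    by (simp add: compactin_PiE)
  then have "compact (PiE UNIV (\<lambda>i. {- K i..K i}) :: (nat \<Rightarrow> real) set)"
    by (simp add: euclidean_product_topology)
  moreover have "\<forall>j. u j \<in> PiE UNIV (\<lambda>i. {- K i..K i})"
    using assms by (auto simp: abs_le_iff minus_le_iff)
  ultimately obtain l r where r: "strict_mono r" "(u \<circ> r) \<longlonglongrightarrow> l"
    unfolding compact_eq_seq_compact_metric seq_compact_def by blast
  have "(\<lambda>j. u (r j) i) \<longlonglongrightarrow> l i" for i
    using continuous_on_tendsto_compose[OF continuous_on_product_coordinates[of i] r(2)]
    by (simp add: o_def)
  then show ?thesis using r(1) by blast
qed

text \<open>
  Constant sequences belong to the space because the weights are summable. A sequence dominated by a
  constant, up to a null sequence in norm, is therefore relatively compact: its coordinates converge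
  along a subsequence, and dominated convergence upgrades this to convergence in norm.
\<close>

lemma ell2_compactness:
  assumes u: "\<And>j. u j \<in> ell2" and e: "\<And>j. e j \<in> ell2" and e0: "(\<lambda>j. wnorm (e j)) \<longlonglongrightarrow> 0"
    and dom: "\<And>j i. \<bar>u j i\<bar> \<le> C + \<bar>e j i\<bar>"
  shows "\<exists>l r. strict_mono (r :: nat \<Rightarrow> nat) \<and>
    limitin (norm_topology ell2 wnorm) (u \<circ> r) l sequentially"
proof -
  have coord: "\<bar>e j i\<bar> \<le> wnorm (e j) / sqrt (wt i)" for j i
  proof -
    have "sqrt (wt i * (e j i)\<^sup>2) \<le> sqrt ((wnorm (e j))\<^sup>2)"
      using coordinate_le_wnorm[OF e[of j], of i] by (rule real_sqrt_le_mono)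
    then show ?thesis using wnorm_nonneg[OF e[of j]] by (simp add: real_sqrt_mult field_simps)
  qed
  have e_lim: "(\<lambda>j. e j i) \<longlonglongrightarrow> 0" for i
  proof (rule Lim_null_comparison)
    show "(\<lambda>j. wnorm (e j) / sqrt (wt i)) \<longlonglongrightarrow> 0"
      using tendsto_divide[OF e0 tendsto_const[of "sqrt (wt i)"]] by (simp add: less_imp_neq[symmetric])
  qed (use coord in auto)
  obtain B where B: "\<And>j. wnorm (e j) \<le> B"
    using convergent_imp_Bseq[of "\<lambda>j. wnorm (e j)"] e0
    by (auto simp: convergent_def Bseq_def abs_le_iff)
  have "\<bar>u j i\<bar> \<le> C + B / sqrt (wt i)" for j i
    using dom[of j i] coord[of j i] divide_right_mono[OF B[of j], of "sqrt (wt i)"] by simp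
  then obtain r l where r: "strict_mono (r :: nat \<Rightarrow> nat)" and l: "\<And>i. (\<lambda>j. u (r j) i) \<longlonglongrightarrow> l i"
    using bounded_coordinates_convergent_subseq[of u "\<lambda>i. C + B / sqrt (wt i)"] by blast
  have lC: "\<bar>l i\<bar> \<le> C" for i
  proof (rule LIMSEQ_le)
    show "(\<lambda>j. \<bar>u (r j) i\<bar>) \<longlonglongrightarrow> \<bar>l i\<bar>" using l by (rule tendsto_rabs)
    show "(\<lambda>j. C + \<bar>e (r j) i\<bar>) \<longlonglongrightarrow> C"
      using tendsto_add[OF tendsto_const tendsto_rabs[OF LIMSEQ_subseq_LIMSEQ[OF e_lim[of i] r]], of C]
      by (simp add: o_def)
  qed (use dom in auto)
  have lmem: "l \<in> ell2"
    using ell2_const[of C] by (rule ell2_dominated) (use lC order_trans[OF abs_ge_zero lC] in auto)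
  have "C \<ge> 0" using order_trans[OF abs_ge_zero lC[of 0]] .
  \<comment> \<open>The part of \<open>\<bar>u (r j) - l\<bar>\<close> not accounted for by \<open>e (r j)\<close>; it has a constant majorant.\<close>
  define d where "d = (\<lambda>j i. max 0 (\<bar>u (r j) i - l i\<bar> - \<bar>e (r j) i\<bar>))"
  have d_bound: "\<bar>d j i\<bar> \<le> 2 * C" for j i
    using dom[of "r j" i] lC[of i] \<open>C \<ge> 0\<close> by (auto simp: d_def)
  have d: "d j \<in> ell2" for j
    using ell2_const[of "2 * C"] by (rule ell2_dominated) (use d_bound \<open>C \<ge> 0\<close> in auto)
  have "(\<lambda>j. suminf (\<lambda>i. wt i * (d j i)\<^sup>2)) \<longlonglongrightarrow> (suminf (\<lambda>i. 0))"
  proof -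
    have lim: "(\<lambda>j. wt i * (d j i)\<^sup>2) \<longlonglongrightarrow> 0" for i
    proof -
      have "(\<lambda>j. u (r j) i - l i) \<longlonglongrightarrow> 0" using l[of i] by (simp add: LIM_zero_iff)
      moreover have "(\<lambda>j. e (r j) i) \<longlonglongrightarrow> 0"
        using LIMSEQ_subseq_LIMSEQ[OF e_lim[of i] r] by (simp add: o_def)
      ultimately have "(\<lambda>j. d j i) \<longlonglongrightarrow> max 0 (\<bar>0\<bar> - \<bar>0\<bar>)"
        unfolding d_def by (intro tendsto_intros)
      then have "(\<lambda>j. wt i * (d j i)\<^sup>2) \<longlonglongrightarrow> wt i * 0\<^sup>2" by (intro tendsto_intros) auto
      then show ?thesis by simp
    qed
    have "norm (wt i * (d j i)\<^sup>2) \<le> wt i * (2 * C)\<^sup>2" for i j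
      using power_mono[OF d_bound[of j i] abs_ge_zero, of 2] by simp
    moreover have "summable (\<lambda>i. wt i * (2 * C)\<^sup>2)" by (simp add: summable_mult2)
    ultimately show ?thesis
      using tannerys_theorem[where a = "\<lambda>i j. wt i * (d j i)\<^sup>2" and b = "\<lambda>_. 0"
          and F = sequentially and M = "\<lambda>i. wt i * (2 * C)\<^sup>2"] lim
      by (auto simp: case_prod_unfold)
  qed
  then have "(\<lambda>j. sqrt ((wnorm (d j))\<^sup>2)) \<longlonglongrightarrow> sqrt 0"
    by (intro tendsto_real_sqrt) (simp add: wnorm_power2[OF d])
  then have d0: "(\<lambda>j. wnorm (d j)) \<longlonglongrightarrow> 0"
    by (simp add: wnorm_nonneg[OF d])
  have le: "wnorm (u (r j) - l) \<le> wnorm (d j) + wnorm (e (r j))" for j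
  proof -
    have abs_e: "(\<lambda>i. \<bar>e (r j) i\<bar>) \<in> ell2" by (rule ell2_abs[OF e])
    have "wnorm (u (r j) - l) \<le> wnorm (d j + (\<lambda>i. \<bar>e (r j) i\<bar>))"
      using ell2_add[OF d abs_e] by (rule wnorm_mono) (auto simp: d_def)
    also have "\<dots> \<le> wnorm (d j) + wnorm (\<lambda>i. \<bar>e (r j) i\<bar>)"
      by (rule wnorm_triangle[OF d abs_e])
    also have "wnorm (\<lambda>i. \<bar>e (r j) i\<bar>) = wnorm (e (r j))"
      by (simp add: wnorm_def ip_def)
    finally show ?thesis .
  qed
  have "(\<lambda>j. wnorm (u (r j) - l)) \<longlonglongrightarrow> 0"
  proof (rule Lim_null_comparison)
    show "(\<lambda>j. wnorm (d j) + wnorm (e (r j))) \<longlonglongrightarrow> 0"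
      using tendsto_add[OF d0 LIMSEQ_subseq_LIMSEQ[OF e0 r]] by (simp add: o_def)
    show "\<forall>\<^sub>F j in sequentially. norm (wnorm (u (r j) - l)) \<le> wnorm (d j) + wnorm (e (r j))"
      using le wnorm_nonneg[OF ell2_diff[OF u lmem]] by auto
  qed
  then show ?thesis
    using limitin_ell2_iff[of "u \<circ> r" l] u lmem r by auto
qed

section \<open>Scalar profiles\<close>

text \<open>
  The building block for the scalar profiles: it has the Lipschitz derivative \<open>max 0 x\<close> and an
  explicit quadratic Taylor bound, which translations, reflections and linear combinations inherit.
\<close>

definition half_sq_pos :: "real \<Rightarrow> real" where
  "half_sq_pos x = (max 0 x)\<^sup>2 / 2"

text \<open>
  Half the squared distance to the interval from \<open>-1\<close> to \<open>1\<close>.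
\<close>

definition trough :: "real \<Rightarrow> real" where
  "trough y = half_sq_pos (y - 1) + half_sq_pos (- y - 1)"

definition trough' :: "real \<Rightarrow> real" where
  "trough' y = max 0 (y - 1) - max 0 (- y - 1)"

text \<open>
  A double well: \<open>- y\<^sup>2 / 2\<close> near the origin and quadratic growth at infinity, with critical points
  \<open>0\<close> and \<open>\<plusminus>2\<close>.
\<close>

definition well :: "real \<Rightarrow> real" where
  "well y = 2 * trough y - y\<^sup>2 / 2"

definition well' :: "real \<Rightarrow> real" where
  "well' y = 2 * trough' y - y"

text \<open>
  The odd function with derivative \<open>min 1 \<bar>y\<bar>\<close>. It is flat enough at the origin to leave the critical
  point \<open>0\<close> of \<^const>\<open>well\<close> in place, and it distinguishes the critical points \<open>2\<close> and \<open>-2\<close> from \<open>0\<close> and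
  from each other.
\<close>

definition tilt :: "real \<Rightarrow> real" where
  "tilt y = half_sq_pos y - half_sq_pos (y - 1) - (half_sq_pos (- y) - half_sq_pos (- y - 1))"

definition tilt' :: "real \<Rightarrow> real" where
  "tilt' y = max 0 y - max 0 (y - 1) + (max 0 (- y) - max 0 (- y - 1))"

lemma half_sq_pos_taylor: "\<bar>half_sq_pos (x + h) - half_sq_pos x - max 0 x * h\<bar> \<le> h\<^sup>2 / 2"
proof -
  consider "0 \<le> x" "0 \<le> x + h" | "x < 0" "x + h < 0" | "0 \<le> x" "x + h < 0" | "x < 0" "0 \<le> x + h"
    by linarith
  then show ?thesis
  proof cases
    case 1
    then have "half_sq_pos (x + h) - half_sq_pos x - max 0 x * h = h\<^sup>2 / 2"
      by (simp add: half_sq_pos_def max_def power2_sum field_simps)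
    then have "\<bar>half_sq_pos (x + h) - half_sq_pos x - max 0 x * h\<bar> = \<bar>h\<^sup>2 / 2\<bar>" by (rule arg_cong)
    then show ?thesis by simp
  next
    case 2
    then show ?thesis by (simp add: half_sq_pos_def max_def)
  next
    case 3
    have "(x + h)\<^sup>2 \<le> h\<^sup>2"
      using 3 by (intro abs_le_square_iff[THEN iffD1]) auto
    moreover have "half_sq_pos (x + h) - half_sq_pos x - max 0 x * h = (h\<^sup>2 - (x + h)\<^sup>2) / 2"
      using 3 by (simp add: half_sq_pos_def max_def power2_sum field_simps)
    ultimately show ?thesis
      using zero_le_power2[of "x + h"] by simp
  next
    case 4
    have "(x + h)\<^sup>2 \<le> h\<^sup>2"
      using 4 by (intro abs_le_square_iff[THEN iffD1]) auto
    then show ?thesis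
      using 4 by (simp add: half_sq_pos_def max_def)
  qed
qed

lemma trough_taylor: "\<bar>trough (y + h) - trough y - trough' y * h\<bar> \<le> h\<^sup>2"
proof -
  have "trough (y + h) - trough y - trough' y * h =
      (half_sq_pos (y - 1 + h) - half_sq_pos (y - 1) - max 0 (y - 1) * h) +
      (half_sq_pos (- y - 1 + - h) - half_sq_pos (- y - 1) - max 0 (- y - 1) * - h)"
    unfolding trough_def trough'_def by (simp add: algebra_simps)
  then show ?thesis
    using half_sq_pos_taylor[of "y - 1" h] half_sq_pos_taylor[of "- y - 1" "- h"]
    by (simp only: abs_le_iff power2_minus) linarith
qed

lemma well_taylor: "\<bar>well (y + h) - well y - well' y * h\<bar> \<le> 3 * h\<^sup>2"
proof -
  have "well (y + h) - well y - well' y * h = 2 * (trough (y + h) - trough y - trough' y * h) - h\<^sup>2 / 2"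
    by (simp add: well_def well'_def power2_sum field_simps)
  moreover have "\<bar>w\<bar> \<le> 3 * q" if "w = 2 * r - q / 2" "\<bar>r\<bar> \<le> q" "0 \<le> q" for w r q :: real
    using that by linarith
  ultimately show ?thesis using trough_taylor[of y h] zero_le_power2[of h] by blast
qed

lemma tilt_taylor: "\<bar>tilt (y + h) - tilt y - tilt' y * h\<bar> \<le> 2 * h\<^sup>2"
proof -
  have "tilt (y + h) - tilt y - tilt' y * h =
      (half_sq_pos (y + h) - half_sq_pos y - max 0 y * h) -
      (half_sq_pos (y - 1 + h) - half_sq_pos (y - 1) - max 0 (y - 1) * h) -
      (half_sq_pos (- y + - h) - half_sq_pos (- y) - max 0 (- y) * - h) +
      (half_sq_pos (- y - 1 + - h) - half_sq_pos (- y - 1) - max 0 (- y - 1) * - h)"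
    unfolding tilt_def tilt'_def by (simp add: algebra_simps)
  then show ?thesis
    using half_sq_pos_taylor[of "y" h] half_sq_pos_taylor[of "- y" "- h"]
      half_sq_pos_taylor[of "y - 1" h] half_sq_pos_taylor[of "- y - 1" "- h"]
    by (simp only: abs_le_iff power2_minus) linarith
qed

lemma max_0_lipschitz: "\<bar>max 0 x - max 0 y\<bar> \<le> \<bar>x - y :: real\<bar>"
  by (auto simp: max_def)

lemma trough'_lipschitz: "\<bar>trough' x - trough' y\<bar> \<le> 2 * \<bar>x - y\<bar>"
  using max_0_lipschitz[of "x - 1" "y - 1"] max_0_lipschitz[of "- x - 1" "- y - 1"]
  unfolding trough'_def by (simp add: abs_le_iff abs_minus_commute)

lemma well'_lipschitz: "\<bar>well' x - well' y\<bar> \<le> 5 * \<bar>x - y\<bar>"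
  using trough'_lipschitz[of x y] unfolding well'_def
  by (smt (verit))

lemma tilt'_lipschitz: "\<bar>tilt' x - tilt' y\<bar> \<le> 4 * \<bar>x - y\<bar>"
  using max_0_lipschitz[of x y] max_0_lipschitz[of "- x" "- y"]
    max_0_lipschitz[of "x - 1" "y - 1"] max_0_lipschitz[of "- x - 1" "- y - 1"]
  unfolding tilt'_def by (simp add: abs_le_iff abs_minus_commute)

lemma tilt'_bound: "\<bar>tilt' y\<bar> \<le> 1"
  unfolding tilt'_def by linarith

lemma tilt_eq: "tilt y = (if \<bar>y\<bar> \<le> 1 then y * \<bar>y\<bar> / 2 else y - sgn y / 2)"
  by (auto simp: tilt_def half_sq_pos_def max_def abs_if sgn_if power2_eq_square field_simps)

lemma trough_eq: "trough y = (max 0 (\<bar>y\<bar> - 1))\<^sup>2 / 2"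
  by (auto simp: trough_def half_sq_pos_def max_def abs_if)

text \<open>
  \<open>half_sq_pos x - half_sq_pos (x - 1)\<close> is the maximum of \<open>a * x - a\<^sup>2 / 2\<close> over \<open>a\<close> between \<open>0\<close> and \<open>1\<close>,
  hence a maximum of functions with Lipschitz constant 1; \<open>c x\<close> is the maximizer.
\<close>

lemma half_sq_pos_diff_lipschitz:
  "\<bar>(half_sq_pos x - half_sq_pos (x - 1)) - (half_sq_pos y - half_sq_pos (y - 1))\<bar> \<le> \<bar>x - y\<bar>"
proof -
  define c where "c = (\<lambda>x :: real. max 0 (min 1 x))"
  have eq: "half_sq_pos x - half_sq_pos (x - 1) = c x * x - (c x)\<^sup>2 / 2" for x
    by (auto simp: c_def half_sq_pos_def max_def min_def power2_eq_square field_simps)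
  have best: "a * x - a\<^sup>2 / 2 \<le> c x * x - (c x)\<^sup>2 / 2" if "0 \<le> a" "a \<le> 1" for a x
  proof -
    have "0 \<le> (c x - a) * (2 * x - c x - a)"
      using that by (auto simp: c_def max_def min_def zero_le_mult_iff)
    then show ?thesis by (simp add: power2_eq_square algebra_simps)
  qed
  have *: "(c x * x - (c x)\<^sup>2 / 2) - (c y * y - (c y)\<^sup>2 / 2) \<le> \<bar>x - y\<bar>" for x y
  proof -
    have cx: "0 \<le> c x" "c x \<le> 1" by (auto simp: c_def)
    have "c x * (x - y) \<le> c x * \<bar>x - y\<bar>" using cx by (intro mult_left_mono) auto
    also have "\<dots> \<le> 1 * \<bar>x - y\<bar>" using cx by (intro mult_right_mono) auto
    finally show ?thesis using best[OF cx, of y] by (simp add: algebra_simps)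
  qed
  show ?thesis unfolding eq using *[of x y] *[of y x] by (simp add: abs_le_iff abs_minus_commute)
qed

lemma tilt_lipschitz: "\<bar>tilt x - tilt y\<bar> \<le> 2 * \<bar>x - y\<bar>"
  using half_sq_pos_diff_lipschitz[of x y] half_sq_pos_diff_lipschitz[of "- x" "- y"]
  unfolding tilt_def by (simp add: abs_le_iff abs_minus_commute)

lemma tilt_0 [simp]: "tilt 0 = 0" and trough_0 [simp]: "trough 0 = 0" and well_0 [simp]: "well 0 = 0"
  by (simp_all add: tilt_def trough_def well_def half_sq_pos_def)

lemma trough_minus [simp]: "trough (- y) = trough y" and well_minus [simp]: "well (- y) = well y"
  and tilt_minus [simp]: "tilt (- y) = - tilt y"
  by (simp_all add: trough_def well_def tilt_def)

lemma trough_eq_0: "\<bar>y\<bar> \<le> 1 \<Longrightarrow> trough y = 0" and trough'_eq_0: "\<bar>y\<bar> \<le> 1 \<Longrightarrow> trough' y = 0"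
  by (auto simp: trough_eq trough'_def)

lemma trough'_ge: "\<bar>y\<bar> - 1 \<le> \<bar>trough' y\<bar>"
  unfolding trough'_def by linarith

lemma trough_le: "trough y \<le> y\<^sup>2 / 2" and trough_nonneg: "0 \<le> trough y"
  and trough_ge: "y\<^sup>2 / 2 - \<bar>y\<bar> \<le> trough y"
proof -
  have "(max 0 (\<bar>y\<bar> - 1))\<^sup>2 \<le> \<bar>y\<bar>\<^sup>2" by (intro power_mono) auto
  then show "trough y \<le> y\<^sup>2 / 2" by (simp add: trough_eq)
  show "0 \<le> trough y" by (simp add: trough_eq)
  have "\<bar>y\<bar> * (\<bar>y\<bar> - 2) \<le> (max 0 (\<bar>y\<bar> - 1))\<^sup>2"
  proof (cases "\<bar>y\<bar> \<le> 1")
    case True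
    then show ?thesis by (auto simp: mult_le_0_iff)
  next
    case False
    then show ?thesis by (simp add: max_def power2_eq_square algebra_simps)
  qed
  moreover have "\<bar>y\<bar> * \<bar>y\<bar> = y\<^sup>2" by (simp add: power2_eq_square)
  ultimately show "y\<^sup>2 / 2 - \<bar>y\<bar> \<le> trough y" by (simp add: trough_eq algebra_simps)
qed

lemma well_bound: "\<bar>well y\<bar> \<le> y\<^sup>2" and well_ge: "y\<^sup>2 / 2 - 2 * \<bar>y\<bar> \<le> well y"
  using trough_le[of y] trough_nonneg[of y] trough_ge[of y] zero_le_power2[of y]
  unfolding well_def by linarith+

lemma tilt_le_abs: "\<bar>tilt y\<bar> \<le> \<bar>y\<bar>" and tilt_le_square: "\<bar>tilt y\<bar> \<le> y\<^sup>2"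
proof -
  have "\<bar>y\<bar> * \<bar>y\<bar> \<le> 1 * \<bar>y\<bar>" if "\<bar>y\<bar> \<le> 1"
    using that by (intro mult_right_mono) auto
  then show "\<bar>tilt y\<bar> \<le> \<bar>y\<bar>"
    by (auto simp: tilt_eq abs_mult abs_if sgn_if)
  show "\<bar>tilt y\<bar> \<le> y\<^sup>2"
  proof (cases "\<bar>y\<bar> \<le> 1")
    case True
    then show ?thesis by (simp add: tilt_eq abs_mult power2_eq_square)
  next
    case False
    then have "1 * \<bar>y\<bar> \<le> \<bar>y\<bar> * \<bar>y\<bar>" by (intro mult_right_mono) auto
    with \<open>\<bar>tilt y\<bar> \<le> \<bar>y\<bar>\<close> show ?thesis by (simp add: power2_eq_square)
  qed
qed

text \<open>
  Within \<open>\<bar>y\<bar> \<le> 1\<close> the equation reads \<open>- y + t * \<bar>y\<bar> = 0\<close>. Beyond, it places \<open>y\<close> within \<open>1 / 2\<close> of \<open>2\<close> or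
  \<open>-2\<close>, where \<open>\<bar>tilt y\<bar> = \<bar>y\<bar> - 1 / 2\<close>.
\<close>

lemma critical_coordinate:
  assumes t: "\<bar>t\<bar> \<le> 1 / 2" and crit: "well' y + t * tilt' y = 0"
  shows "y = 0 \<or> 1 \<le> \<bar>tilt y\<bar> \<and> \<bar>tilt y\<bar> \<le> 2"
proof -
  consider "\<bar>y\<bar> \<le> 1" | "1 < y" | "y < -1" by linarith
  then show ?thesis
  proof cases
    case 1
    then have "well' y = - y" "tilt' y = \<bar>y\<bar>"
      by (auto simp: well'_def trough'_def tilt'_def max_def abs_if)
    then have "\<bar>y\<bar> = \<bar>t\<bar> * \<bar>y\<bar>" using crit by (metis abs_mult abs_abs add.commute add_eq_0_iff minus_minus)
    also have "\<dots> \<le> 1 / 2 * \<bar>y\<bar>" using t by (rule mult_right_mono) simp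
    finally show ?thesis by simp
  next
    case 2
    then have "well' y = y - 2" "tilt' y = 1" "tilt y = y - 1 / 2"
      by (auto simp: well'_def trough'_def tilt'_def tilt_eq)
    then show ?thesis using crit t by auto
  next
    case 3
    then have "well' y = y + 2" "tilt' y = 1" "tilt y = y + 1 / 2"
      by (auto simp: well'_def trough'_def tilt'_def tilt_eq)
    then show ?thesis using crit t by auto
  qed
qed

text \<open>
  \<^const>\<open>well'\<close> stays within distance 2 of the identity, and \<^const>\<open>tilt'\<close> is bounded by 1. This is the
  domination needed for the Palais-Smale condition.
\<close>

lemma coordinate_bound: "\<bar>y\<bar> \<le> 2 + \<bar>t\<bar> + \<bar>well' y + t * tilt' y\<bar>"
proof -
  have "\<bar>t * tilt' y\<bar> \<le> \<bar>t\<bar> * 1"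
    unfolding abs_mult using tilt'_bound by (rule mult_left_mono) simp
  moreover have "\<bar>y\<bar> \<le> 2 + \<bar>well' y\<bar>"
    unfolding well'_def trough'_def by (simp add: max_def abs_if)
  ultimately show ?thesis by linarith
qed

text \<open>
  The left-hand side is the minimum over \<open>\<bar>y\<bar>\<close> of the lower bound \<open>y\<^sup>2 / 2 - (2 + \<bar>t\<bar>) * \<bar>y\<bar>\<close>.
\<close>

lemma well_tilt_ge: "- ((2 + \<bar>t\<bar>)\<^sup>2 / 2) \<le> well y + t * tilt y"
proof -
  have "\<bar>t * tilt y\<bar> \<le> \<bar>t\<bar> * \<bar>y\<bar>"
    unfolding abs_mult using tilt_le_abs by (rule mult_left_mono) simp
  moreover have "0 \<le> (\<bar>y\<bar> - (2 + \<bar>t\<bar>))\<^sup>2" by simp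
  then have "- ((2 + \<bar>t\<bar>)\<^sup>2 / 2) \<le> y\<^sup>2 / 2 - 2 * \<bar>y\<bar> - \<bar>t\<bar> * \<bar>y\<bar>"
    by (simp add: power2_diff algebra_simps)
  ultimately show ?thesis using well_ge[of y] by linarith
qed

section \<open>The functional and its critical points\<close>

lemma wnorm_power2_split:
  assumes u: "u \<in> ell2"
  shows "summable (\<lambda>i. wt (Suc i) * (u (Suc i))\<^sup>2)"
    and "(wnorm u)\<^sup>2 = (u 0)\<^sup>2 + (suminf (\<lambda>i. wt (Suc i) * (u (Suc i))\<^sup>2))"
  using ell2_summable[OF u] suminf_split_head[OF ell2_summable[OF u]]
  by (simp_all add: summable_Suc_iff[of "\<lambda>i. wt i * (u i)\<^sup>2"] wnorm_power2[OF u])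

lemma ip_split:
  assumes "u \<in> ell2" "v \<in> ell2"
  shows "ip u v = u 0 * v 0 + (suminf (\<lambda>i. wt (Suc i) * (u (Suc i) * v (Suc i))))"
  using suminf_split_head[OF ip_summable[OF assms]] by (simp add: ip_def)

lemma abs_coordinate_0_le_wnorm: "u \<in> ell2 \<Longrightarrow> \<bar>u 0\<bar> \<le> wnorm u"
  using coordinate_le_wnorm[of u 0] wnorm_nonneg[of u] abs_le_square_iff[of "u 0" "wnorm u"] by simp

lemma weighted_sum_bound:
  assumes u: "u \<in> ell2" and f: "\<And>i. \<bar>f i\<bar> \<le> a * (u (Suc i))\<^sup>2 + b" and a: "0 \<le> a"
  shows "summable (\<lambda>i. wt (Suc i) * f i)"
    and "\<bar>(suminf (\<lambda>i. wt (Suc i) * f i))\<bar> \<le> a * (wnorm u)\<^sup>2 + b / 3"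
proof -
  let ?g = "\<lambda>i. a * (wt (Suc i) * (u (Suc i))\<^sup>2) + b * wt (Suc i)"
  have g: "summable ?g"
    by (intro summable_add summable_mult wnorm_power2_split u summable_wt_Suc)
  have le: "norm (wt (Suc i) * f i) \<le> ?g i" for i
    using mult_left_mono[OF f wt_nonneg[of "Suc i"]] by (simp add: abs_mult algebra_simps)
  show "summable (\<lambda>i. wt (Suc i) * f i)"
    by (rule summable_comparison_test'[OF g, of 0]) (rule le)
  have "\<bar>(suminf (\<lambda>i. wt (Suc i) * f i))\<bar> \<le> (suminf (\<lambda>i. ?g i))"
    using norm_suminf_le[of "\<lambda>i. wt (Suc i) * f i" ?g] le g by simp
  also have "\<dots> = a * (suminf (\<lambda>i. wt (Suc i) * (u (Suc i))\<^sup>2)) + b / 3"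
    using wnorm_power2_split(1)[OF u]
    by (simp add: suminf_add[symmetric] suminf_mult summable_mult)
  also have "\<dots> \<le> a * (wnorm u)\<^sup>2 + b / 3"
    using a by (auto simp: wnorm_power2_split(2)[OF u] intro!: mult_left_mono)
  finally show "\<bar>(suminf (\<lambda>i. wt (Suc i) * f i))\<bar> \<le> a * (wnorm u)\<^sup>2 + b / 3" .
qed

text \<open>
  Coordinate 0 is the parameter \<open>t\<close>, the others are the \<open>y i\<close>. The weights are those of the norm, so
  that the gradient acts coordinatewise on the \<open>y i\<close> and constant bounds on coordinates define
  elements of the space.
\<close>

definition energy :: "(nat \<Rightarrow> real) \<Rightarrow> real" where
  "energy u = trough (u 0) + (suminf (\<lambda>i. wt (Suc i) * (well (u (Suc i)) + u 0 * tilt (u (Suc i)))))"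

definition energy_gradient :: "(nat \<Rightarrow> real) \<Rightarrow> nat \<Rightarrow> real" where
  "energy_gradient u i = (case i of
     0 \<Rightarrow> trough' (u 0) + (suminf (\<lambda>j. wt (Suc j) * tilt (u (Suc j))))
   | Suc j \<Rightarrow> well' (u (Suc j)) + u 0 * tilt' (u (Suc j)))"

lemma energy_gradient_simps:
  "energy_gradient u 0 = trough' (u 0) + (suminf (\<lambda>j. wt (Suc j) * tilt (u (Suc j))))"
  "energy_gradient u (Suc j) = well' (u (Suc j)) + u 0 * tilt' (u (Suc j))"
  by (simp_all add: energy_gradient_def)

lemma summable_well: "u \<in> ell2 \<Longrightarrow> summable (\<lambda>i. wt (Suc i) * well (u (Suc i)))"
  and summable_tilt: "u \<in> ell2 \<Longrightarrow> summable (\<lambda>i. wt (Suc i) * tilt (u (Suc i)))"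
  using weighted_sum_bound(1)[of u "\<lambda>i. well (u (Suc i))" 1 0]
    weighted_sum_bound(1)[of u "\<lambda>i. tilt (u (Suc i))" 1 0] well_bound tilt_le_square by auto

lemma summable_energy:
  assumes u: "u \<in> ell2"
  shows "summable (\<lambda>i. wt (Suc i) * (well (u (Suc i)) + t * tilt (u (Suc i))))"
  using summable_add[OF summable_well[OF u] summable_mult[OF summable_tilt[OF u], of t]]
  by (simp add: algebra_simps)

lemma energy_gradient_ell2:
  assumes u: "u \<in> ell2"
  shows "energy_gradient u \<in> ell2"
proof -
  define c where "c = \<bar>u 0\<bar> + \<bar>energy_gradient u 0\<bar>"
  define v where "v = 5 *\<^sub>R (\<lambda>i. \<bar>u i\<bar>) + (\<lambda>_. c)"
  have v: "v \<in> ell2"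
    unfolding v_def by (intro ell2_add ell2_scaleR ell2_abs u ell2_const)
  have "\<bar>energy_gradient u i\<bar> \<le> \<bar>v i\<bar>" for i
  proof (cases i)
    case 0
    then show ?thesis by (simp add: v_def c_def scaleR_fun_def)
  next
    case (Suc j)
    have "\<bar>well' (u i)\<bar> \<le> 5 * \<bar>u i\<bar>"
      using well'_lipschitz[of "u i" 0] by (simp add: well'_def trough'_def)
    moreover have "\<bar>u 0 * tilt' (u i)\<bar> \<le> \<bar>u 0\<bar>"
      using mult_left_mono[OF tilt'_bound[of "u i"], of "\<bar>u 0\<bar>"] by (simp add: abs_mult)
    ultimately have "\<bar>energy_gradient u i\<bar> \<le> 5 * \<bar>u i\<bar> + \<bar>u 0\<bar>"
      using Suc by (simp add: energy_gradient_simps)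
    then show ?thesis by (simp add: v_def c_def scaleR_fun_def)
  qed
  then show ?thesis using v ell2_dominated by blast
qed

text \<open>
  All scalar remainders are quadratic. The mixed remainder of \<open>t * tilt y\<close> contains the product of the
  increments of \<open>t\<close> and of \<open>y i\<close>; it is split into their squares, and the squared increment of \<open>t\<close>,
  common to all \<open>i\<close>, is summable because the weights are.
\<close>

lemma energy_taylor:
  assumes u: "u \<in> ell2" and h: "h \<in> ell2"
  shows "\<bar>energy (u + h) - energy u - ip (energy_gradient u) h\<bar> \<le> (6 + 2 * \<bar>u 0\<bar>) * (wnorm h)\<^sup>2"
proof -
  let ?t = "u 0" and ?s = "h 0"
  define W where "W = (\<lambda>i. well (u (Suc i) + h (Suc i)) - well (u (Suc i)) - well' (u (Suc i)) * h (Suc i))"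
  define T where "T = (\<lambda>i. tilt (u (Suc i) + h (Suc i)) - tilt (u (Suc i)) - tilt' (u (Suc i)) * h (Suc i))"
  define D where "D = (\<lambda>i. tilt (u (Suc i) + h (Suc i)) - tilt (u (Suc i)))"
  have R: "\<bar>W i + ?t * T i + ?s * D i\<bar> \<le> (4 + 2 * \<bar>?t\<bar>) * (h (Suc i))\<^sup>2 + ?s\<^sup>2" for i
  proof -
    have "\<bar>W i\<bar> \<le> 3 * (h (Suc i))\<^sup>2" unfolding W_def by (rule well_taylor)
    moreover have "\<bar>?t * T i\<bar> \<le> \<bar>?t\<bar> * (2 * (h (Suc i))\<^sup>2)"
      unfolding abs_mult T_def by (intro mult_left_mono tilt_taylor) simp
    moreover have "\<bar>?s * D i\<bar> \<le> \<bar>?s\<bar> * (2 * \<bar>h (Suc i)\<bar>)"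
      unfolding abs_mult D_def
      using tilt_lipschitz[of "u (Suc i) + h (Suc i)" "u (Suc i)"] by (intro mult_left_mono) auto
    moreover have "\<bar>?s\<bar> * (2 * \<bar>h (Suc i)\<bar>) \<le> ?s\<^sup>2 + (h (Suc i))\<^sup>2"
      using sum_squares_bound[of "\<bar>?s\<bar>" "\<bar>h (Suc i)\<bar>"] by simp
    moreover have "(4 + 2 * \<bar>?t\<bar>) * (h (Suc i))\<^sup>2 = 3 * (h (Suc i))\<^sup>2 + \<bar>?t\<bar> * (2 * (h (Suc i))\<^sup>2) + (h (Suc i))\<^sup>2"
      by (simp add: algebra_simps)
    ultimately show ?thesis by linarith
  qed
  have uh: "u + h \<in> ell2" by (rule ell2_add[OF u h])
  have "energy (u + h) - energy u - ip (energy_gradient u) h =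
      (trough (?t + ?s) - trough ?t - trough' ?t * ?s) +
      (suminf (\<lambda>i. wt (Suc i) * (W i + ?t * T i + ?s * D i)))"
  proof -
    let ?A = "\<lambda>i. wt (Suc i) * (well ((u + h) (Suc i)) + (u + h) 0 * tilt ((u + h) (Suc i)))"
    let ?B = "\<lambda>i. wt (Suc i) * (well (u (Suc i)) + ?t * tilt (u (Suc i)))"
    let ?C = "\<lambda>i. wt (Suc i) * tilt (u (Suc i))"
    let ?G = "\<lambda>i. wt (Suc i) * (energy_gradient u (Suc i) * h (Suc i))"
    have G: "summable ?G"
      using ip_summable[OF energy_gradient_ell2[OF u] h]
      by (simp add: summable_Suc_iff[of "\<lambda>i. wt i * (energy_gradient u i * h i)"])
    have "(suminf (\<lambda>i. wt (Suc i) * (W i + ?t * T i + ?s * D i))) = (suminf (\<lambda>i. ?A i - ?B i - ?s * ?C i - ?G i))"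
      by (rule suminf_cong) (simp add: W_def T_def D_def energy_gradient_simps algebra_simps)
    also have "\<dots> = (suminf (\<lambda>i. ?A i)) - (suminf (\<lambda>i. ?B i)) - ?s * (suminf (\<lambda>i. ?C i)) - (suminf (\<lambda>i. ?G i))"
      using summable_energy[OF uh, of "(u + h) 0"] summable_energy[OF u, of ?t] summable_tilt[OF u] G
      by (simp add: suminf_diff[symmetric] summable_diff summable_mult suminf_mult)
    finally show ?thesis
      by (simp add: energy_def ip_split[OF energy_gradient_ell2[OF u] h] energy_gradient_simps(1)
          algebra_simps)
  qed
  moreover have "\<bar>(suminf (\<lambda>i. wt (Suc i) * (W i + ?t * T i + ?s * D i)))\<bar> \<le> (4 + 2 * \<bar>?t\<bar>) * (wnorm h)\<^sup>2 + ?s\<^sup>2 / 3"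
    using weighted_sum_bound(2)[OF h, of "\<lambda>i. W i + ?t * T i + ?s * D i"] R by simp
  moreover have "\<bar>trough (?t + ?s) - trough ?t - trough' ?t * ?s\<bar> \<le> ?s\<^sup>2"
    by (rule trough_taylor)
  moreover have "?s\<^sup>2 \<le> (wnorm h)\<^sup>2" using coordinate_le_wnorm[OF h, of 0] by simp
  moreover have "0 \<le> ?s\<^sup>2" by simp
  moreover have "(6 + 2 * \<bar>?t\<bar>) * (wnorm h)\<^sup>2 = (4 + 2 * \<bar>?t\<bar>) * (wnorm h)\<^sup>2 + 2 * (wnorm h)\<^sup>2"
    by (simp add: algebra_simps)
  ultimately show ?thesis by linarith
qed

text \<open>
  The increment of the gradient is dominated coordinatewise by a multiple of \<open>\<bar>h\<bar>\<close> plus a constant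
  sequence proportional to the norm of \<open>h\<close>.
\<close>

lemma energy_gradient_lipschitz_at:
  assumes u: "u \<in> ell2" and h: "h \<in> ell2"
  shows "wnorm (energy_gradient (u + h) - energy_gradient u)
    \<le> (5 + 4 * \<bar>u 0\<bar> + 5 * wnorm (\<lambda>_. 1)) * wnorm h"
proof -
  let ?\<delta> = "wnorm h"
  define v where "v = (5 + 4 * \<bar>u 0\<bar>) *\<^sub>R (\<lambda>i. \<bar>h i\<bar>) + (5 * ?\<delta>) *\<^sub>R (\<lambda>_. 1)"
  have uh: "u + h \<in> ell2" by (rule ell2_add[OF u h])
  have h0: "\<bar>h 0\<bar> \<le> ?\<delta>" by (rule abs_coordinate_0_le_wnorm[OF h])
  have d: "0 \<le> ?\<delta>" by (rule wnorm_nonneg[OF h])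
  have v: "v \<in> ell2"
    unfolding v_def by (intro ell2_add ell2_scaleR ell2_abs h ell2_const)
  have pos: "v i = (5 + 4 * \<bar>u 0\<bar>) * \<bar>h i\<bar> + 5 * ?\<delta>" for i
    by (simp add: v_def scaleR_fun_def)
  have "\<bar>(energy_gradient (u + h) - energy_gradient u) i\<bar> \<le> \<bar>v i\<bar>" for i
  proof (cases i)
    case (Suc j)
    let ?y = "u (Suc j)" and ?k = "h (Suc j)"
    have "(energy_gradient (u + h) - energy_gradient u) i =
        (well' (?y + ?k) - well' ?y) + u 0 * (tilt' (?y + ?k) - tilt' ?y) + h 0 * tilt' (?y + ?k)"
      using Suc by (simp add: energy_gradient_simps algebra_simps)
    moreover have "\<bar>well' (?y + ?k) - well' ?y\<bar> \<le> 5 * \<bar>?k\<bar>"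
      using well'_lipschitz[of "?y + ?k" ?y] by simp
    moreover have "\<bar>u 0 * (tilt' (?y + ?k) - tilt' ?y)\<bar> \<le> \<bar>u 0\<bar> * (4 * \<bar>?k\<bar>)"
      unfolding abs_mult using tilt'_lipschitz[of "?y + ?k" ?y] by (intro mult_left_mono) auto
    moreover have "\<bar>h 0 * tilt' (?y + ?k)\<bar> \<le> \<bar>h 0\<bar> * 1"
      unfolding abs_mult by (intro mult_left_mono tilt'_bound) simp
    moreover have "(5 + 4 * \<bar>u 0\<bar>) * \<bar>?k\<bar> = 5 * \<bar>?k\<bar> + \<bar>u 0\<bar> * (4 * \<bar>?k\<bar>)"
      by (simp add: algebra_simps)
    moreover have "\<bar>a + b + c\<bar> \<le> x + y + z" if "\<bar>a\<bar> \<le> x" "\<bar>b\<bar> \<le> y" "\<bar>c\<bar> \<le> z"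
      for a b c x y z :: real
      using that by linarith
    ultimately have "\<bar>(energy_gradient (u + h) - energy_gradient u) i\<bar> \<le>
        (5 + 4 * \<bar>u 0\<bar>) * \<bar>?k\<bar> + \<bar>h 0\<bar> * 1"
      by metis
    then show ?thesis using Suc h0 d pos[of i] by simp
  next
    case 0
    have "\<bar>(suminf (\<lambda>j. wt (Suc j) * (tilt (u (Suc j) + h (Suc j)) - tilt (u (Suc j)))))\<bar> \<le> 2 * ?\<delta>"
    proof (cases "?\<delta> = 0")
      case True
      then have "h = 0" using h by (simp add: wnorm_eq_0_iff)
      then show ?thesis by simp
    next
      case False
      with d have dpos: "0 < ?\<delta>" by simp
      have "\<bar>tilt (u (Suc j) + h (Suc j)) - tilt (u (Suc j))\<bar> \<le> 1 / ?\<delta> * (h (Suc j))\<^sup>2 + ?\<delta>" for j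
      proof -
        \<comment> \<open>Young's inequality with parameter the norm of \<open>h\<close>, which makes a linear bound out of a quadratic one.\<close>
        have "2 * \<bar>h (Suc j)\<bar> * ?\<delta> \<le> (h (Suc j))\<^sup>2 + ?\<delta>\<^sup>2"
          using sum_squares_bound[of "\<bar>h (Suc j)\<bar>" ?\<delta>] by simp
        then have "2 * \<bar>h (Suc j)\<bar> \<le> 1 / ?\<delta> * (h (Suc j))\<^sup>2 + ?\<delta>"
          using dpos by (simp add: field_simps power2_eq_square)
        then show ?thesis using tilt_lipschitz[of "u (Suc j) + h (Suc j)" "u (Suc j)"] by simp
      qed
      then have "\<bar>(suminf (\<lambda>j. wt (Suc j) * (tilt (u (Suc j) + h (Suc j)) - tilt (u (Suc j)))))\<bar>
          \<le> 1 / ?\<delta> * ?\<delta>\<^sup>2 + ?\<delta> / 3"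
        using dpos by (intro weighted_sum_bound(2)[OF h]) auto
      also have "\<dots> \<le> 2 * ?\<delta>" using dpos by (simp add: power2_eq_square)
      finally show ?thesis .
    qed
    moreover have "(suminf (\<lambda>j. wt (Suc j) * tilt ((u + h) (Suc j)))) - (suminf (\<lambda>j. wt (Suc j) * tilt (u (Suc j)))) =
        (suminf (\<lambda>j. wt (Suc j) * (tilt (u (Suc j) + h (Suc j)) - tilt (u (Suc j)))))"
      using suminf_diff[OF summable_tilt[OF uh] summable_tilt[OF u]] by (simp add: algebra_simps)
    moreover have "\<bar>trough' (u 0 + h 0) - trough' (u 0)\<bar> \<le> 2 * \<bar>h 0\<bar>"
      using trough'_lipschitz[of "u 0 + h 0" "u 0"] by simp
    ultimately have "\<bar>(energy_gradient (u + h) - energy_gradient u) 0\<bar> \<le> 5 * ?\<delta>"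
      using h0 d by (simp add: energy_gradient_simps)
    moreover have "0 \<le> (5 + 4 * \<bar>u 0\<bar>) * \<bar>h 0\<bar>" by simp
    ultimately show ?thesis unfolding 0 pos by linarith
  qed
  then have "wnorm (energy_gradient (u + h) - energy_gradient u) \<le> wnorm v"
    using v by (rule wnorm_mono[rotated])
  also have "\<dots> \<le> (5 + 4 * \<bar>u 0\<bar>) * wnorm (\<lambda>i. \<bar>h i\<bar>) + 5 * ?\<delta> * wnorm (\<lambda>_. 1)"
  proof -
    have "wnorm ((5 + 4 * \<bar>u 0\<bar>) *\<^sub>R (\<lambda>i. \<bar>h i\<bar>)) = (5 + 4 * \<bar>u 0\<bar>) * wnorm (\<lambda>i. \<bar>h i\<bar>)"
      by (simp only: wnorm_scaleR[OF ell2_abs[OF h]] abs_of_nonneg)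
    moreover have "wnorm ((5 * ?\<delta>) *\<^sub>R (\<lambda>_. 1)) = 5 * ?\<delta> * wnorm (\<lambda>_. 1)"
      using d by (simp only: wnorm_scaleR[OF ell2_const] abs_of_nonneg)
    ultimately show ?thesis
      unfolding v_def
      using wnorm_triangle[OF ell2_scaleR[OF ell2_abs[OF h]] ell2_scaleR[OF ell2_const]] by metis
  qed
  also have "wnorm (\<lambda>i. \<bar>h i\<bar>) = ?\<delta>"
    by (simp add: wnorm_def ip_def)
  finally show ?thesis by (simp only: distrib_left distrib_right mult_ac)
qed

lemma energy_C1: "C1_functional_on ell2 wnorm energy"
  and frechet_derivative_energy:
    "u \<in> ell2 \<Longrightarrow> frechet_derivative_on ell2 wnorm energy u = riesz (energy_gradient u)"
proof -
  have *: "\<exists>K. \<forall>h\<in>ell2. \<bar>energy (u + h) - energy u - ip (energy_gradient u) h\<bar> \<le> K * (wnorm h)\<^sup>2"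
    "\<exists>K. \<forall>h\<in>ell2. wnorm (energy_gradient (u + h) - energy_gradient u) \<le> K * wnorm h"
    if "u \<in> ell2" for u
    using energy_taylor[OF that] energy_gradient_lipschitz_at[OF that] by blast+
  show "C1_functional_on ell2 wnorm energy"
    by (rule gradient_imp_C1(1)[OF energy_gradient_ell2 *])
  show "u \<in> ell2 \<Longrightarrow> frechet_derivative_on ell2 wnorm energy u = riesz (energy_gradient u)"
    by (rule gradient_imp_C1(2)[OF energy_gradient_ell2 *])
qed

lemma cond_A1_energy: "cond_A1 ell2 energy"
proof -
  have "energy 0 = 0" by (simp add: energy_def)
  moreover have "energy (- u) = energy u" for u
    by (simp add: energy_def)
  moreover have "bdd_below (energy ` ell2)"
  proof (rule bdd_belowI2)
    fix u assume u: "u \<in> ell2"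
    let ?t = "\<bar>u 0\<bar>" and ?F = "\<lambda>i. well (u (Suc i)) + u 0 * tilt (u (Suc i))"
    have "(suminf (\<lambda>i. wt (Suc i) * - ((2 + ?t)\<^sup>2 / 2))) \<le> (suminf (\<lambda>i. wt (Suc i) * ?F i))"
      by (intro suminf_le mult_left_mono well_tilt_ge summable_mult2 summable_wt_Suc summable_energy u) simp
    then have "- ((2 + ?t)\<^sup>2 / 6) \<le> (suminf (\<lambda>i. wt (Suc i) * ?F i))"
      using suminf_mult2[OF summable_wt_Suc, of "- ((2 + ?t)\<^sup>2 / 2)"] by simp
    moreover have "?t\<^sup>2 / 2 - ?t \<le> trough (u 0)"
      using trough_ge[of "u 0"] by simp
    moreover have "(2 + ?t)\<^sup>2 = 4 + 4 * ?t + ?t\<^sup>2" by (simp add: power2_sum)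
    moreover have "0 \<le> (?t - 5 / 2)\<^sup>2" by simp
    then have "- 25 / 4 \<le> ?t\<^sup>2 - 5 * ?t" by (simp add: power2_diff power_divide)
    ultimately show "- 10 \<le> energy u" unfolding energy_def by linarith
  qed
  ultimately show ?thesis by (simp add: cond_A1_def)
qed

text \<open>
  If some \<open>a i\<close> is nonzero, the first such term is at least its weight, while all later terms together
  amount to at most two thirds of that weight.
\<close>

lemma leading_term_dominates:
  assumes a: "\<And>i. a i = 0 \<or> 1 \<le> \<bar>a i\<bar> \<and> \<bar>a i\<bar> \<le> 2" and sum: "(suminf (\<lambda>i. wt (Suc i) * a i)) = 0"
  shows "a i = (0::real)"
proof (rule ccontr)
  assume "a i \<noteq> 0"
  define n where "n = (LEAST i. a i \<noteq> 0)"
  have n: "a n \<noteq> 0" unfolding n_def using \<open>a i \<noteq> 0\<close> by (rule LeastI)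
  have before: "a j = 0" if "j < n" for j using not_less_Least[of j] that unfolding n_def by blast
  have a2: "\<bar>a j\<bar> \<le> 2" for j using a[of j] by auto
  have le: "norm (wt (Suc j) * a j) \<le> wt (Suc j) * 2" for j
    using a2[of j] by (simp add: abs_mult)
  have S: "summable (\<lambda>j. wt (Suc j) * a j)"
    by (rule summable_comparison_test'[of "\<lambda>j. wt (Suc j) * 2" 0]) (use le in \<open>auto simp: summable_mult2\<close>)
  let ?tail = "(suminf (\<lambda>j. wt (Suc (j + Suc n)) * a (j + Suc n)))"
  have "?tail + (\<Sum>j<Suc n. wt (Suc j) * a j) = 0"
    using suminf_split_initial_segment[OF S, of "Suc n"] sum by simp
  then have eq: "?tail = - (wt (Suc n) * a n)"
    using before by simp
  have "(\<lambda>j. wt (Suc (j + Suc n))) sums (4 / 3 * wt (Suc (Suc n)))"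
    using sums_wt_tail[of "Suc (Suc n)"] by (simp add: add_ac)
  then have "(\<lambda>j. wt (Suc (j + Suc n)) * 2) sums (4 / 3 * wt (Suc (Suc n)) * 2)"
    by (rule sums_mult2)
  then have tail2: "summable (\<lambda>j. wt (Suc (j + Suc n)) * 2)"
    "(suminf (\<lambda>j. wt (Suc (j + Suc n)) * 2)) = 2 / 3 * wt (Suc n)"
    by (auto simp: sums_iff wt_Suc)
  have "\<bar>?tail\<bar> \<le> (suminf (\<lambda>j. wt (Suc (j + Suc n)) * 2))"
    using norm_suminf_le[OF _ tail2(1), of "\<lambda>j. wt (Suc (j + Suc n)) * a (j + Suc n)"] le by simp
  moreover have "\<bar>?tail\<bar> = wt (Suc n) * \<bar>a n\<bar>"
    unfolding eq by (simp add: abs_mult)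
  ultimately have "wt (Suc n) * \<bar>a n\<bar> \<le> 2 / 3 * wt (Suc n)"
    unfolding tail2(2) by linarith
  moreover have "wt (Suc n) * 1 \<le> wt (Suc n) * \<bar>a n\<bar>"
    using a[of n] n by (intro mult_left_mono) auto
  ultimately show False using wt_pos[of "Suc n"] by linarith
qed

text \<open>
  The equations for the \<open>y i\<close> leave for each of them only 0 or a value at which \<open>\<bar>tilt\<bar>\<close> lies between
  1 and 2. In the equation for \<open>t\<close> the term \<^const>\<open>trough'\<close> vanishes, and the remaining sum has to be
  free of nonzero terms. So \<open>y = 0\<close>.
\<close>

lemma energy_critical_near_axis:
  assumes u: "u \<in> ell2" and t: "\<bar>u 0\<bar> \<le> 1 / 2" and crit: "energy_gradient u = 0"
  shows "energy u = 0"
proof -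
  have "well' (u (Suc i)) + u 0 * tilt' (u (Suc i)) = 0" for i
    using fun_cong[OF crit, of "Suc i"] by (simp add: energy_gradient_simps)
  then have alt: "u (Suc i) = 0 \<or> 1 \<le> \<bar>tilt (u (Suc i))\<bar> \<and> \<bar>tilt (u (Suc i))\<bar> \<le> 2" for i
    using critical_coordinate[OF t] by blast
  have "(suminf (\<lambda>j. wt (Suc j) * tilt (u (Suc j)))) = 0"
    using fun_cong[OF crit, of 0] t by (simp add: energy_gradient_simps trough'_eq_0)
  then have "tilt (u (Suc i)) = 0" for i
    by (rule leading_term_dominates[rotated]) (metis alt tilt_0)
  then have "u (Suc i) = 0" for i
    using alt[of i] by auto
  then show ?thesis
    using t by (simp add: energy_def trough_eq_0)
qed

text \<open>
  Critical points close to the origin have \<open>\<bar>t\<bar> \<le> 1 / 2\<close> and hence energy 0.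
\<close>

lemma not_cond_C1_energy: "\<not> cond_C1 ell2 wnorm energy"
proof
  assume "cond_C1 ell2 wnorm energy"
  then obtain u where u: "\<And>j. u j \<in> ell2" and crit: "\<And>j. frechet_derivative_on ell2 wnorm energy (u j) = 0"
    and neg: "\<And>j. energy (u j) < 0" and lim: "limitin (norm_topology ell2 wnorm) u 0 sequentially"
    unfolding cond_C1_def by blast
  have "(\<lambda>j. wnorm (u j)) \<longlonglongrightarrow> 0"
    using lim u by (simp add: limitin_ell2_iff)
  then obtain j where "wnorm (u j) < 1 / 2"
    using order_tendstoD(2)[of "\<lambda>j. wnorm (u j)" 0 sequentially "1 / 2"]
    by (auto simp: eventually_sequentially)
  then have "\<bar>u j 0\<bar> \<le> 1 / 2"
    using abs_coordinate_0_le_wnorm[OF u[of j]] by simp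
  moreover have "energy_gradient (u j) = 0"
    using crit[of j] u[of j] by (simp add: frechet_derivative_energy riesz_eq_0_iff energy_gradient_ell2)
  ultimately have "energy (u j) = 0"
    using energy_critical_near_axis[OF u] by blast
  then show False using neg[of j] by simp
qed

text \<open>
  The equations for the \<open>y i\<close> bound them by \<open>2 + \<bar>t\<bar>\<close> up to the gradient, which tends to 0 in norm.
  The weights of the \<open>y i\<close> sum up to \<open>1 / 3\<close>, so that the equation for \<open>t\<close> then bounds \<open>\<bar>t\<bar>\<close>:
  the slope \<open>\<bar>t\<bar> - 1\<close> of \<^const>\<open>trough\<close> outgrows a third of \<open>\<bar>t\<bar>\<close>. Compactness follows by domination.
\<close>

lemma palais_smale_energy: "palais_smale ell2 wnorm energy c"
  unfolding palais_smale_def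
proof (intro allI impI)
  fix u :: "nat \<Rightarrow> nat \<Rightarrow> real"
  assume "\<forall>j. u j \<in> ell2"
    and der: "(\<lambda>j. dual_norm ell2 wnorm (frechet_derivative_on ell2 wnorm energy (u j))) \<longlonglongrightarrow> 0"
  then have u: "\<And>j. u j \<in> ell2" by blast
  define e where "e = (\<lambda>j. energy_gradient (u j))"
  have e: "e j \<in> ell2" for j
    unfolding e_def by (rule energy_gradient_ell2[OF u])
  have e0: "(\<lambda>j. wnorm (e j)) \<longlonglongrightarrow> 0"
    using der u by (simp add: e_def frechet_derivative_energy dual_norm_riesz energy_gradient_ell2)
  have coord: "\<bar>u j (Suc i)\<bar> \<le> 2 + \<bar>u j 0\<bar> + \<bar>e j (Suc i)\<bar>" for j i
    using coordinate_bound[of "u j (Suc i)" "u j 0"] by (simp add: e_def energy_gradient_simps)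
  obtain B where B: "\<And>j. wnorm (e j) \<le> B"
    using convergent_imp_Bseq[of "\<lambda>j. wnorm (e j)"] e0
    by (auto simp: convergent_def Bseq_def abs_le_iff)
  have t: "\<bar>u j 0\<bar> \<le> 3 + 2 * B + 2 * B\<^sup>2" for j
  proof -
    have "\<bar>tilt (u j (Suc i))\<bar> \<le> 1 * (e j (Suc i))\<^sup>2 + (3 + \<bar>u j 0\<bar>)" for i
    proof -
      have "2 * \<bar>e j (Suc i)\<bar> \<le> (e j (Suc i))\<^sup>2 + 1"
        using sum_squares_bound[of "\<bar>e j (Suc i)\<bar>" 1] by simp
      then have "\<bar>e j (Suc i)\<bar> \<le> (e j (Suc i))\<^sup>2 + 1"
        using abs_ge_zero[of "e j (Suc i)"] by linarith
      then show ?thesis using tilt_le_abs[of "u j (Suc i)"] coord[of j i] by linarith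
    qed
    then have "\<bar>(suminf (\<lambda>i. wt (Suc i) * tilt (u j (Suc i))))\<bar> \<le> 1 * (wnorm (e j))\<^sup>2 + (3 + \<bar>u j 0\<bar>) / 3"
      by (intro weighted_sum_bound(2)[OF e]) auto
    moreover have "(wnorm (e j))\<^sup>2 \<le> B\<^sup>2"
      using B[of j] wnorm_nonneg[OF e[of j]] by (intro power_mono)
    moreover have "trough' (u j 0) = e j 0 - (suminf (\<lambda>i. wt (Suc i) * tilt (u j (Suc i))))"
      by (simp add: e_def energy_gradient_simps)
    then have "\<bar>trough' (u j 0)\<bar> \<le> \<bar>e j 0\<bar> + \<bar>(suminf (\<lambda>i. wt (Suc i) * tilt (u j (Suc i))))\<bar>"
      by (metis abs_triangle_ineq4)
    moreover have "\<bar>e j 0\<bar> \<le> B"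
      using abs_coordinate_0_le_wnorm[OF e[of j]] B[of j] by simp
    moreover have "\<bar>u j 0\<bar> - 1 \<le> \<bar>trough' (u j 0)\<bar>" by (rule trough'_ge)
    moreover have "0 \<le> B" "0 \<le> B\<^sup>2" using B[of j] wnorm_nonneg[OF e[of j]] by auto
    moreover have "t \<le> 3 + 2 * b + 2 * q" if "s \<le> 1 * n + (3 + t) / 3" "n \<le> q" "d \<le> x + s" "x \<le> b"
      "t - 1 \<le> d" "0 \<le> b" "0 \<le> q" for t b q s n d x :: real
      using that by argo
    ultimately show ?thesis by blast
  qed
  have "\<bar>u j i\<bar> \<le> (5 + 2 * B + 2 * B\<^sup>2) + \<bar>e j i\<bar>" for j i
    using t[of j] coord[of j "i - 1"] by (cases i) auto
  then show "\<exists>l r. strict_mono (r :: nat \<Rightarrow> nat) \<and>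
      limitin (norm_topology ell2 wnorm) (u \<circ> r) l sequentially"
    by (rule ell2_compactness[OF u e e0])
qed

section \<open>Spheres of negative energy\<close>

definition coordinate_subspace :: "nat \<Rightarrow> (nat \<Rightarrow> real) set" where
  "coordinate_subspace k = {u. \<forall>i. i \<notin> {1..k} \<longrightarrow> u i = 0}"

lemma subspace_coordinate_subspace: "subspace (coordinate_subspace k)"
  by (auto simp: subspace_def coordinate_subspace_def scaleR_fun_def)

lemma sum_fun_apply: "(\<Sum>a\<in>A. f a) x = (\<Sum>a\<in>A. f a x :: real)"
  by (induction A rule: infinite_finite_induct) auto

text \<open>
  The unit vectors form a basis.
\<close>

lemma dim_coordinate_subspace: "dim (coordinate_subspace k) = k"
proof -
  define b where "b = (\<lambda>i j :: nat. if j = i then 1 else 0 :: real)"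
  have inj: "inj_on b {1..k}"
  proof (rule inj_onI)
    fix i j assume "b i = b j"
    then have "b i i = b j i" by simp
    then show "i = j" by (simp add: b_def split: if_splits)
  qed
  have comb: "(\<Sum>v\<in>b ` {1..k}. c v *\<^sub>R v) i = (if i \<in> {1..k} then c (b i) else 0)" for c i
  proof -
    have "(\<Sum>v\<in>b ` {1..k}. c v *\<^sub>R v) i = (\<Sum>j\<in>{1..k}. if i = j then c (b j) else 0)"
      unfolding sum_fun_apply sum.reindex[OF inj]
      by (rule sum.cong) (auto simp: scaleR_fun_def b_def)
    then show ?thesis by (simp add: sum.delta)
  qed
  show ?thesis
  proof (rule dim_unique)
    show "b ` {1..k} \<subseteq> coordinate_subspace k"
      by (auto simp: b_def coordinate_subspace_def)
    show "coordinate_subspace k \<subseteq> span (b ` {1..k})"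
    proof
      fix u assume u: "u \<in> coordinate_subspace k"
      have "u = (\<Sum>v\<in>b ` {1..k}. u (THE i. v = b i) *\<^sub>R v)"
      proof
        fix i
        have "(THE i'. b i = b i') = i"
          by (rule the_equality) (auto simp: b_def fun_eq_iff split: if_splits)
        then show "u i = (\<Sum>v\<in>b ` {1..k}. u (THE i. v = b i) *\<^sub>R v) i"
          using u unfolding comb by (auto simp: coordinate_subspace_def)
      qed
      moreover have "(\<Sum>v\<in>b ` {1..k}. u (THE i. v = b i) *\<^sub>R v) \<in> span (b ` {1..k})"
        by (intro span_sum span_scale span_base)
      ultimately show "u \<in> span (b ` {1..k})" by simp
    qed
    have "c (b i) = 0" if "(\<Sum>v\<in>b ` {1..k}. c v *\<^sub>R v) = 0" "i \<in> {1..k}" for c i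
      using fun_cong[OF that(1), of i] that(2) unfolding comb by simp
    then show "independent (b ` {1..k})"
      by (subst dependent_finite) auto
    show "card (b ` {1..k}) = k"
      using card_image[OF inj] by simp
  qed
qed

lemma coordinate_subspace_ell2: "u \<in> coordinate_subspace k \<Longrightarrow> u \<in> ell2"
  unfolding ell2_def mem_Collect_eq
  by (rule summable_finite[of "{1..k}"]) (auto simp: coordinate_subspace_def)

lemma wnorm_power2_coordinate_subspace:
  "u \<in> coordinate_subspace k \<Longrightarrow> (wnorm u)\<^sup>2 = (\<Sum>i\<in>{1..k}. wt i * (u i)\<^sup>2)"
  unfolding wnorm_power2[OF coordinate_subspace_ell2]
  by (rule suminf_finite) (auto simp: coordinate_subspace_def)

text \<open>
  The weights decrease, so this radius is the largest one that keeps all coordinates within the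
  interval from \<open>-1\<close> to \<open>1\<close>, where \<^const>\<open>well\<close> is \<open>- y\<^sup>2 / 2\<close>.
\<close>

definition small_sphere :: "nat \<Rightarrow> (nat \<Rightarrow> real) set" where
  "small_sphere k = {u \<in> coordinate_subspace k. wnorm u = sqrt (wt k)}"

lemma energy_small_sphere:
  assumes "u \<in> small_sphere k"
  shows "energy u = - (wt k / 2)"
proof -
  have uk: "u \<in> coordinate_subspace k" and n: "(wnorm u)\<^sup>2 = wt k"
    using assms by (simp_all add: small_sphere_def)
  have u: "u \<in> ell2" by (rule coordinate_subspace_ell2[OF uk])
  have u0: "u 0 = 0" using uk by (simp add: coordinate_subspace_def)
  have "well (u i) = - 1 / 2 * (u i)\<^sup>2" for i
  proof -
    have "\<bar>u i\<bar> \<le> 1"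
    proof (cases "i \<in> {1..k}")
      case True
      then have "wt k \<le> wt i" by (simp add: wt_def power_decreasing)
      then have "wt i * (u i)\<^sup>2 \<le> wt i * 1"
        using coordinate_le_wnorm[OF u, of i] n by linarith
      then have "(u i)\<^sup>2 \<le> 1" by simp
      then show ?thesis by (simp add: abs_square_le_1)
    next
      case False
      then show ?thesis using uk by (auto simp: coordinate_subspace_def)
    qed
    then show ?thesis by (simp add: well_def trough_eq_0)
  qed
  then have "energy u = (suminf (\<lambda>i. - 1 / 2 * (wt (Suc i) * (u (Suc i))\<^sup>2)))"
    by (simp add: energy_def u0)
  also have "\<dots> = - 1 / 2 * (wnorm u)\<^sup>2"
    using wnorm_power2_split[OF u] u0
    by (subst suminf_mult) auto
  finally show ?thesis using n by simp
qed

lemma SUP_energy_small_sphere: "A \<subseteq> small_sphere k \<Longrightarrow> (SUP u\<in>A. ereal (energy u)) < 0"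
proof -
  assume A: "A \<subseteq> small_sphere k"
  have "(SUP u\<in>A. ereal (energy u)) \<le> ereal (- (wt k / 2))"
    using A energy_small_sphere[of _ k] by (intro SUP_least) (simp add: subset_iff)
  also have "\<dots> < 0" by simp
  finally show ?thesis .
qed

lemma cond_A3'_energy: "cond_A3' ell2 wnorm energy"
  unfolding cond_A3'_def
proof (intro allI impI exI conjI)
  fix k :: nat
  show "subspace (coordinate_subspace k)" by (rule subspace_coordinate_subspace)
  show "coordinate_subspace k \<subseteq> ell2" using coordinate_subspace_ell2 by blast
  show "dim (coordinate_subspace k) = k" by (rule dim_coordinate_subspace)
  show "sqrt (wt k) > 0" by simp
  show "(SUP u\<in>{u \<in> coordinate_subspace k. wnorm u = sqrt (wt k)}. ereal (energy u)) < 0"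
    by (rule SUP_energy_small_sphere[of _ k]) (simp add: small_sphere_def)
qed

lemma small_sphere_closed_symmetric: "small_sphere k \<in> closed_symmetric_sets ell2 wnorm"
proof -
  have sub: "small_sphere k \<subseteq> ell2"
    using coordinate_subspace_ell2 by (auto simp: small_sphere_def)
  have "0 \<notin> small_sphere k" by (simp add: small_sphere_def)
  moreover have "- u \<in> small_sphere k" if "u \<in> small_sphere k" for u
    using that by (auto simp: small_sphere_def coordinate_subspace_def wnorm_def ip_def)
  moreover have "l \<in> small_sphere k"
    if range: "range \<sigma> \<subseteq> small_sphere k" and lim: "limitin ell2.mtopology \<sigma> l sequentially" for \<sigma> l
  proof -
    have \<sigma>: "\<sigma> n \<in> ell2" "\<sigma> n \<in> coordinate_subspace k" "wnorm (\<sigma> n) = sqrt (wt k)" for n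
      using range sub by (auto simp: small_sphere_def)
    have l: "l \<in> ell2" and l0: "(\<lambda>n. wnorm (\<sigma> n - l)) \<longlonglongrightarrow> 0"
      using lim limitin_ell2_iff[of \<sigma> l] \<sigma> by (auto simp: norm_topology_def)
    have d: "\<sigma> n - l \<in> ell2" "l - \<sigma> n \<in> ell2" for n using \<sigma> l by (auto intro: ell2_diff)
    have "l i = 0" if "i \<notin> {1..k}" for i
    proof -
      have "wt i * (l i)\<^sup>2 \<le> (wnorm (\<sigma> n - l))\<^sup>2" for n
        using coordinate_le_wnorm[OF d(1)[of n], of i] \<sigma>(2)[of n] that by (simp add: coordinate_subspace_def)
      moreover have "(\<lambda>n. (wnorm (\<sigma> n - l))\<^sup>2) \<longlonglongrightarrow> 0\<^sup>2" by (intro tendsto_power l0)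
      ultimately have "wt i * (l i)\<^sup>2 \<le> 0\<^sup>2"
        using LIMSEQ_le_const[of "\<lambda>n. (wnorm (\<sigma> n - l))\<^sup>2" "0\<^sup>2"] by blast
      then show ?thesis using wt_pos[of i] by (auto simp: mult_le_0_iff not_le[symmetric])
    qed
    moreover have "wnorm l = sqrt (wt k)"
    proof -
      have "\<bar>wnorm l - sqrt (wt k)\<bar> \<le> wnorm (\<sigma> n - l)" for n
      proof -
        have "wnorm (l - \<sigma> n) = wnorm (\<sigma> n - l)"
          by (simp add: wnorm_def ip_def power2_commute[of "l _"] flip: power2_eq_square)
        then show ?thesis
          using wnorm_triangle[OF l d(1)[of n]] wnorm_triangle[OF \<sigma>(1)[of n] d(2)[of n]] \<sigma>(3)[of n]
          by simp
      qed
      then have "\<bar>wnorm l - sqrt (wt k)\<bar> \<le> 0"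
        using l0 by (intro LIMSEQ_le_const) auto
      then show ?thesis by simp
    qed
    ultimately show ?thesis by (simp add: small_sphere_def coordinate_subspace_def)
  qed
  then have "closedin (norm_topology ell2 wnorm) (small_sphere k)"
    unfolding norm_topology_def ell2.metric_closedin_iff_sequentially_closed using sub by blast
  ultimately show ?thesis
    using sub by (auto simp: closed_symmetric_sets_def)
qed

text \<open>
  Rescaling the coordinates maps the standard sphere oddly and continuously onto this one.
\<close>

lemma genus_small_sphere: "enat (Suc m) \<le> genus ell2 wnorm (small_sphere (Suc m))"
proof -
  define \<rho> where "\<rho> = sqrt (wt (Suc m))"
  define g where "g = (\<lambda>(x :: nat \<Rightarrow> real) i.
    if i \<in> {1..Suc m} then \<rho> * x (i - 1) / sqrt (wt i) else 0)"
  have g_mem: "g x \<in> coordinate_subspace (Suc m)" for x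
    by (simp add: g_def coordinate_subspace_def)
  have g_diff: "g x - g y = g (x - y)" for x y
    by (auto simp: g_def fun_eq_iff diff_divide_distrib right_diff_distrib)
  have g_wnorm: "(wnorm (g x))\<^sup>2 = \<rho>\<^sup>2 * (\<Sum>i\<le>m. (x i)\<^sup>2)" for x
  proof -
    have "(wnorm (g x))\<^sup>2 = (\<Sum>i\<in>{1..Suc m}. \<rho>\<^sup>2 * (x (i - 1))\<^sup>2)"
      unfolding wnorm_power2_coordinate_subspace[OF g_mem]
      by (rule sum.cong) (auto simp: g_def power_mult_distrib power_divide)
    also have "\<dots> = (\<Sum>i\<in>{0..m}. \<rho>\<^sup>2 * (x i)\<^sup>2)"
      by (rule sum.reindex_bij_witness[of _ Suc "\<lambda>i. i - 1"]) auto
    finally show ?thesis by (simp add: sum_distrib_left atMost_atLeast0)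
  qed
  have \<rho>: "0 < \<rho>" by (simp add: \<rho>_def)
  have g_wnorm': "wnorm (g x) = \<rho> * sqrt (\<Sum>i\<le>m. (x i)\<^sup>2)" for x
    using wnorm_nonneg[OF coordinate_subspace_ell2[OF g_mem], of x] g_wnorm[of x] \<rho>
    by (metis abs_of_nonneg less_imp_le real_sqrt_abs real_sqrt_mult)
  have "g x \<in> small_sphere (Suc m)" if "x \<in> topspace (nsphere m)" for x
    using that g_mem by (simp add: small_sphere_def g_wnorm' nsphere \<rho>_def)
  moreover have "continuous_map (nsphere m) (norm_topology ell2 wnorm) g"
    unfolding norm_topology_def ell2.continuous_map_to_metric
  proof (intro ballI allI impI)
    fix x and \<epsilon> :: real
    assume x: "x \<in> topspace (nsphere m)" and \<epsilon>: "\<epsilon> > 0"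
    define U where "U = {y \<in> topspace (nsphere m). \<rho> * sqrt (\<Sum>i\<le>m. (x i - y i)\<^sup>2) \<in> {..<\<epsilon>}}"
    have "continuous_map (nsphere m) euclideanreal (\<lambda>y. \<rho> * sqrt (\<Sum>i\<le>m. (x i - y i)\<^sup>2))"
      by (intro continuous_map_real_mult continuous_map_sqrt continuous_map_sum continuous_map_real_pow
          continuous_map_diff continuous_map_nsphere_projection) auto
    then have "openin (nsphere m) U"
      unfolding U_def by (rule openin_continuous_map_preimage) auto
    moreover have "x \<in> U" using x \<epsilon> by (simp add: U_def)
    moreover have "g y \<in> ell2.mball (g x) \<epsilon>" if "y \<in> U" for y
      using that coordinate_subspace_ell2[OF g_mem]
      by (simp add: U_def norm_dist_def g_diff g_wnorm')
    ultimately show "\<exists>U. openin (nsphere m) U \<and> x \<in> U \<and> (\<forall>y\<in>U. g y \<in> ell2.mball (g x) \<epsilon>)"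
      by blast
  qed
  ultimately have "continuous_map (nsphere m) (subtopology (norm_topology ell2 wnorm) (small_sphere (Suc m))) g"
    by (auto simp: continuous_map_in_subtopology)
  then show ?thesis
    by (rule enat_le_genus_if_odd_map_from_nsphere) (auto simp: g_def fun_eq_iff)
qed

lemma cond_A3_energy: "cond_A3 ell2 wnorm energy"
  unfolding cond_A3_def
proof (intro allI impI)
  fix k :: nat assume "k \<ge> 1"
  then obtain m where k: "k = Suc m" by (cases k) auto
  show "\<exists>A\<in>closed_symmetric_sets ell2 wnorm.
      enat k \<le> genus ell2 wnorm A \<and> (SUP u\<in>A. ereal (energy u)) < 0"
    using small_sphere_closed_symmetric[of k] genus_small_sphere[of m]
      SUP_energy_small_sphere[of "small_sphere k" k] k by blast
qed

section \<open>The counterexample\<close>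

theorem theorem1p6:
  shows "(\<exists>(X :: (nat \<Rightarrow> real) set) nrm I.
            banach_space_on X nrm \<and> C1_functional_on X nrm I \<and>
            cond_A1 X I \<and> cond_A2'' X nrm I \<and> cond_A3' X nrm I \<and> \<not> cond_C1 X nrm I) \<and>
         (\<exists>(X :: (nat \<Rightarrow> real) set) nrm I.
            banach_space_on X nrm \<and> C1_functional_on X nrm I \<and>
            cond_A1 X I \<and> cond_A2'' X nrm I \<and> cond_A3 X nrm I \<and> \<not> cond_C1 X nrm I)"
proof -
  have "cond_A2'' ell2 wnorm energy"
    by (simp add: cond_A2''_def palais_smale_energy)
  then show ?thesis
    using banach_space_ell2 energy_C1 cond_A1_energy cond_A3'_energy cond_A3_energy
      not_cond_C1_energy by blast
qed

end
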